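(* Let $p\ge 1$ be an integer. A LIRK-W method of type 2 with $s$ stages and real coefficients $a_{i,j},\gamma_{i,j},b_i,g_i$ has order $p$ if and only if $$\sum_{j=1}^s \Phi^2_j(\tau)=\frac{1}{\gamma(\tau)}\qquad\text{for all } \tau\in T \text{ with } \rho(\tau)\le p,$$ and $$\sum_{j=1}^s \Phi^2_j(\tau)=0\qquad\text{for all } \tau\in LW_2\setminus T \text{ with } \rho(\tau)\le p.$$
   Context: **Problem.** Consider the autonomous initial value problem $y'=F(y)$, $y(t_n)=y_n$, with $F:\mathbb{R}^N\to\mathbb{R}^N$ smooth, and let $t\mapsto \mathbf{L}(t)\in\mathbb{R}^{N\times N}$ be an arbitrary smooth time-dependent matrix. **Method.** Coefficients are real numbers $a_{i,j}$ ($1\le j<i\le s$), $\gamma_{i,j}$ ($1\le j\le i\le s$), $b_i,g_i$ ($1\le i\le s$), with $a_{i,j}=0$ for $j\ge i$ and $\gamma_{i,j}=0$ for $j>i$. One step of size $h$ of the LIRK-W (linearly-implicit Runge-Kutta-W) method of type 2 is $$Y_i=y_n+h\sum_{j=1}^{i-1}a_{i,j}F(Y_j)+h\,\mathbf{L}\sum_{j=1}^{i-1}\gamma_{i,j}Y_j+h\gamma_{i,i}\mathbf{L}_iY_i\quad(i=1,\dots,s),$$ $$y_{n+1}=y_n+h\sum_{j=1}^s b_jF(Y_j)+h\,\mathbf{L}\sum_{j=1}^s g_jY_j,\qquad \mathbf{L}=\mathbf{L}(t_n),\quad \mathbf{L}_i=\mathbf{L}(t_n+h\gamma_{i,i}).$$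 (For $h$ small the stages are well defined.) The method has order $p$ if, for every $N$, every smooth $F$, every smooth $\mathbf{L}(\cdot)$ and every $t_n,y_n$, the Taylor expansions in $h$ at $h=0$ of $y_{n+1}$ and of the exact solution $y(t_n+h)$ agree up to and including the $h^p$ terms, i.e. $y_{n+1}-y(t_n+h)=O(h^{p+1})$. **Trees.** Consider finite nonempty rooted trees (unordered, up to isomorphism) whose vertices are each of one of three kinds: meagre, fat, or square. $LW_2$ is the set of such trees in which the root is not square, every fat vertex has at most one child, and every square vertex has exactly one child, which is square or fat; meagre vertices may have any number of children of any kind. $T\subset LW_2$ is the set of trees all of whose vertices are meagre. Notation: $[\,]_\bullet$ is the single meagre vertex and $[\tau_1,\dots,\tau_m]_\bullet$ is the tree obtained by attaching $\tau_1,\dots,\tau_m$ to a meagre root; $[\,]_\circ$ is the single fat vertex and $[\tau_1]_\circ$ attaches $\tau_1$ to a fat root; for $q\ge1$, $[\tau_1]_{\theta_q}$ (resp. $[\,]_{\theta_q}$) is the tree consisting of a chain of $q$ square vertices starting at the root, followed by a fat vertex, to which $\tau_1$ (resp. nothing) is attached. Subtrees of a tree in $LW_2$ may be of the form $[\cdot]_{\theta_q}$, although the tree itself may not. $\rho(\tau)$ is the number of vertices of $\tau$ (all kinds counted). For $\tau\in T$, $\gamma(\tau)$ is defined by $\gamma([\,]_\bullet)=1$ and $\gamma([\tau_1,\dots,\tau_m]_\bullet)=\rho(\tau)\gamma(\tau_1)\cdots\gamma(\tau_m)$ (not to be confused with the coefficients $\gamma_{i,j}$). **Elementary weights** (all sums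 over $k$ from $1$ to $s$): - $\Phi^2_j([\,]_\bullet)=b_j$; $\ \Phi^2_j([\tau_1,\dots,\tau_m]_\bullet)=b_j\,\bar\Phi^2_j(\tau_1)\cdots\bar\Phi^2_j(\tau_m)$; - $\Phi^2_j([\,]_\circ)=g_j$; $\ \Phi^2_j([\tau_1]_\circ)=g_j\,\bar\Phi^2_j(\tau_1)$; - $\bar\Phi^2_j([\,]_\bullet)=\sum_k a_{j,k}$; $\ \bar\Phi^2_j([\tau_1,\dots,\tau_m]_\bullet)=\sum_k a_{j,k}\,\bar\Phi^2_k(\tau_1)\cdots\bar\Phi^2_k(\tau_m)$; - $\bar\Phi^2_j([\,]_\circ)=\sum_k\gamma_{j,k}$; $\ \bar\Phi^2_j([\tau_1]_\circ)=\sum_k\gamma_{j,k}\,\bar\Phi^2_k(\tau_1)$; - $\bar\Phi^2_j([\,]_{\theta_q})=\gamma_{j,j}^{q+1}$; $\ \bar\Phi^2_j([\tau_1]_{\theta_q})=\gamma_{j,j}^{q+1}\,\bar\Phi^2_j(\tau_1)$. *)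

theory Defs
  imports
    "HOL-Analysis.Analysis"
    "HOL-Library.Multiset"
    "HOL-Library.Landau_Symbols"
begin

section \<open>Smooth problems on N-dimensional space\<close>

text \<open>
  The definition of order quantifies over the dimension N, so N cannot be a type here. Points of
  N-dimensional real space are the elements of the topspace of the library's
  \<^const>\<open>Euclidean_space\<close> N, i.e. functions from nat to real that vanish from index N on;
  the components are the indices below N.
\<close>

text \<open>Partial derivatives along the coordinates in the list; the head is applied last.\<close>

primrec iterated_partial ::
    "nat list \<Rightarrow> ((nat \<Rightarrow> real) \<Rightarrow> real) \<Rightarrow> (nat \<Rightarrow> real) \<Rightarrow> real" where
  "iterated_partial [] f = f"
| "iterated_partial (i # is) f =
     (\<lambda>x. deriv (\<lambda>t. iterated_partial is f (x(i := t))) (x i))"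

text \<open>
  Infinitely often continuously differentiable: all partial derivatives of all orders exist and
  are continuous. Since \<^const>\<open>deriv\<close> is total, existence is required separately.
\<close>

definition smooth_fun :: "nat \<Rightarrow> ((nat \<Rightarrow> real) \<Rightarrow> real) \<Rightarrow> bool" where
  "smooth_fun N f \<longleftrightarrow>
     (\<forall>is. set is \<subseteq> {..<N} \<longrightarrow>
        continuous_map (Euclidean_space N) euclideanreal (iterated_partial is f) \<and>
        (\<forall>i<N. \<forall>x\<in>topspace (Euclidean_space N).
           (\<lambda>t. iterated_partial is f (x(i := t))) field_differentiable (at (x i))))"

definition smooth_vector_field :: "nat \<Rightarrow> ((nat \<Rightarrow> real) \<Rightarrow> nat \<Rightarrow> real) \<Rightarrow> bool" where
  "smooth_vector_field N F \<longleftrightarrow>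
     F \<in> topspace (Euclidean_space N) \<rightarrow> topspace (Euclidean_space N) \<and>
     (\<forall>m<N. smooth_fun N (\<lambda>x. F x m))"

definition smooth_matrix :: "nat \<Rightarrow> (real \<Rightarrow> nat \<Rightarrow> nat \<Rightarrow> real) \<Rightarrow> bool" where
  "smooth_matrix N L \<longleftrightarrow>
     (\<forall>m<N. \<forall>l<N. \<forall>k t. (deriv ^^ k) (\<lambda>u. L u m l) field_differentiable (at t))"

definition mat_vec :: "nat \<Rightarrow> (nat \<Rightarrow> nat \<Rightarrow> real) \<Rightarrow> (nat \<Rightarrow> real) \<Rightarrow> nat \<Rightarrow> real" where
  "mat_vec N A v m = (\<Sum>l<N. A m l * v l)"

definition local_solution ::
    "nat \<Rightarrow> ((nat \<Rightarrow> real) \<Rightarrow> nat \<Rightarrow> real) \<Rightarrow> real \<Rightarrow> (nat \<Rightarrow> real) \<Rightarrow> (real \<Rightarrow> nat \<Rightarrow> real) \<Rightarrow> bool" where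
  "local_solution N F t0 y0 y \<longleftrightarrow>
     y t0 = y0 \<and>
     (\<exists>\<delta>>0. \<forall>t\<in>ball t0 \<delta>.
        y t \<in> topspace (Euclidean_space N) \<and>
        (\<forall>m<N. ((\<lambda>u. y u m) has_real_derivative F (y t) m) (at t)))"


section \<open>LIRK-W methods of type 2\<close>

definition lirkw2_stages ::
    "nat \<Rightarrow> (nat \<Rightarrow> nat \<Rightarrow> real) \<Rightarrow> (nat \<Rightarrow> nat \<Rightarrow> real) \<Rightarrow>
     nat \<Rightarrow> ((nat \<Rightarrow> real) \<Rightarrow> nat \<Rightarrow> real) \<Rightarrow> (real \<Rightarrow> nat \<Rightarrow> nat \<Rightarrow> real) \<Rightarrow>
     real \<Rightarrow> (nat \<Rightarrow> real) \<Rightarrow> real \<Rightarrow> (nat \<Rightarrow> nat \<Rightarrow> real) \<Rightarrow> bool" where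
  "lirkw2_stages s a \<gamma> N F L t0 y0 h Y \<longleftrightarrow>
     (\<forall>i\<in>{1..s}. Y i \<in> topspace (Euclidean_space N) \<and>
        (\<forall>m<N. Y i m =
           y0 m
           + h * (\<Sum>j=1..<i. a i j * F (Y j) m)
           + h * mat_vec N (L t0) (\<lambda>l. \<Sum>j=1..<i. \<gamma> i j * Y j l) m
           + h * \<gamma> i i * mat_vec N (L (t0 + h * \<gamma> i i)) (Y i) m))"

definition lirkw2_update ::
    "nat \<Rightarrow> (nat \<Rightarrow> real) \<Rightarrow> (nat \<Rightarrow> real) \<Rightarrow>
     nat \<Rightarrow> ((nat \<Rightarrow> real) \<Rightarrow> nat \<Rightarrow> real) \<Rightarrow> (real \<Rightarrow> nat \<Rightarrow> nat \<Rightarrow> real) \<Rightarrow>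
     real \<Rightarrow> (nat \<Rightarrow> real) \<Rightarrow> real \<Rightarrow> (nat \<Rightarrow> nat \<Rightarrow> real) \<Rightarrow> nat \<Rightarrow> real" where
  "lirkw2_update s b g N F L t0 y0 h Y m =
     y0 m
     + h * (\<Sum>j=1..s. b j * F (Y j) m)
     + h * mat_vec N (L t0) (\<lambda>l. \<Sum>j=1..s. g j * Y j l) m"

text \<open>
  For small h the stages exist and are unique, because the matrices
  \<open>I - h \<gamma>\<^sub>i\<^sub>i L\<^sub>i\<close> are invertible; likewise the local solution exists and is
  unique near \<open>t0\<close>. Hence the quantifiers over \<open>y\<close> and over the stage family \<open>Y\<close> pick out
  the one exact and the one numerical solution, as germs at \<open>h = 0\<close>.
\<close>

definition lirkw2_has_order ::
    "nat \<Rightarrow> (nat \<Rightarrow> nat \<Rightarrow> real) \<Rightarrow> (nat \<Rightarrow> nat \<Rightarrow> real) \<Rightarrow> (nat \<Rightarrow> real) \<Rightarrow> (nat \<Rightarrow> real) \<Rightarrow> nat \<Rightarrow> bool" where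
  "lirkw2_has_order s a \<gamma> b g p \<longleftrightarrow>
     (\<forall>N F L t0 y0 y Y.
        smooth_vector_field N F \<longrightarrow>
        smooth_matrix N L \<longrightarrow>
        y0 \<in> topspace (Euclidean_space N) \<longrightarrow>
        local_solution N F t0 y0 y \<longrightarrow>
        (\<forall>\<^sub>F h in at 0. lirkw2_stages s a \<gamma> N F L t0 y0 h (Y h)) \<longrightarrow>
        (\<forall>m<N. (\<lambda>h. lirkw2_update s b g N F L t0 y0 h (Y h) m - y (t0 + h) m)
                 \<in> O[at 0](\<lambda>h. h ^ (p + 1))))"


section \<open>Trees\<close>

text \<open>
  Children form a finite multiset, so elements of this type are exactly the isomorphism classes
  of finite nonempty unordered rooted trees with labelled vertices.
\<close>

datatype 'k rtree = Node (root: 'k) (children: "'k rtree multiset")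

datatype kind = Meagre | Fat | Square

text \<open>The vertex conditions for \<open>LW\<^sub>2\<close> at all vertices, without the condition on the root.\<close>

inductive lw2_subtree :: "kind rtree \<Rightarrow> bool" where
  meagre: "(\<forall>\<tau>\<in>#ts. lw2_subtree \<tau>) \<Longrightarrow> lw2_subtree (Node Meagre ts)"
| fat: "size ts \<le> 1 \<Longrightarrow> (\<forall>\<tau>\<in>#ts. lw2_subtree \<tau>) \<Longrightarrow> lw2_subtree (Node Fat ts)"
| square: "root \<tau> \<in> {Square, Fat} \<Longrightarrow> lw2_subtree \<tau> \<Longrightarrow> lw2_subtree (Node Square {#\<tau>#})"

definition LW2 :: "kind rtree set" where
  "LW2 = {\<tau>. lw2_subtree \<tau> \<and> root \<tau> \<noteq> Square}"

definition meagre_trees :: "kind rtree set" where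
  "meagre_trees = {\<tau> \<in> LW2. set_rtree \<tau> \<subseteq> {Meagre}}"

primrec rho :: "'k rtree \<Rightarrow> nat" where
  "rho (Node c ts) = 1 + sum_mset (image_mset rho ts)"

primrec tree_gamma :: "'k rtree \<Rightarrow> nat" where
  "tree_gamma (Node c ts) = rho (Node c ts) * prod_mset (image_mset tree_gamma ts)"


section \<open>Elementary weights\<close>

text \<open>
  The Boolean argument says whether the parent of the root is square. A chain of q square
  vertices and the fat vertex below it contribute one factor \<open>\<gamma>\<^sub>j\<^sub>j\<close> each and leave
  the index j unchanged, whereas a fat vertex with a different parent contributes a sum over
  \<open>\<gamma>\<^sub>j\<^sub>k\<close>. The defining equations by tree shape are derived below.
\<close>

primrec Phi_bar_aux ::
    "nat \<Rightarrow> (nat \<Rightarrow> nat \<Rightarrow> real) \<Rightarrow> (nat \<Rightarrow> nat \<Rightarrow> real) \<Rightarrow> kind rtree \<Rightarrow> bool \<Rightarrow> nat \<Rightarrow> real" where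
  "Phi_bar_aux s a \<gamma> (Node c ts) under_square j =
     (case c of
        Meagre \<Rightarrow> (\<Sum>k=1..s. a j k * (\<Prod>\<phi>\<in>#image_mset (Phi_bar_aux s a \<gamma>) ts. \<phi> False k))
      | Fat \<Rightarrow>
          if under_square
          then \<gamma> j j * (\<Prod>\<phi>\<in>#image_mset (Phi_bar_aux s a \<gamma>) ts. \<phi> False j)
          else (\<Sum>k=1..s. \<gamma> j k * (\<Prod>\<phi>\<in>#image_mset (Phi_bar_aux s a \<gamma>) ts. \<phi> False k))
      | Square \<Rightarrow> \<gamma> j j * (\<Prod>\<phi>\<in>#image_mset (Phi_bar_aux s a \<gamma>) ts. \<phi> True j))"

definition Phi_bar ::
    "nat \<Rightarrow> (nat \<Rightarrow> nat \<Rightarrow> real) \<Rightarrow> (nat \<Rightarrow> nat \<Rightarrow> real) \<Rightarrow> nat \<Rightarrow> kind rtree \<Rightarrow> real" where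
  "Phi_bar s a \<gamma> j \<tau> = Phi_bar_aux s a \<gamma> \<tau> False j"

text \<open>The value for a root vertex of kind square is irrelevant: such trees are not in \<open>LW\<^sub>2\<close>.\<close>

definition Phi ::
    "nat \<Rightarrow> (nat \<Rightarrow> nat \<Rightarrow> real) \<Rightarrow> (nat \<Rightarrow> nat \<Rightarrow> real) \<Rightarrow> (nat \<Rightarrow> real) \<Rightarrow> (nat \<Rightarrow> real) \<Rightarrow>
     nat \<Rightarrow> kind rtree \<Rightarrow> real" where
  "Phi s a \<gamma> b g j \<tau> =
     (case root \<tau> of Meagre \<Rightarrow> b j | Fat \<Rightarrow> g j | Square \<Rightarrow> 0) *
     (\<Prod>\<tau>'\<in>#children \<tau>. Phi_bar s a \<gamma> j \<tau>')"

text \<open>\<open>theta q ts\<close> is a chain of q square vertices ending in a fat vertex with children ts.\<close>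

definition theta :: "nat \<Rightarrow> kind rtree multiset \<Rightarrow> kind rtree" where
  "theta q ts = ((\<lambda>\<tau>. Node Square {#\<tau>#}) ^^ q) (Node Fat ts)"

lemma Phi_simps:
  "Phi s a \<gamma> b g j (Node Meagre {#}) = b j"
  "Phi s a \<gamma> b g j (Node Meagre ts) = b j * (\<Prod>\<tau>\<in>#ts. Phi_bar s a \<gamma> j \<tau>)"
  "Phi s a \<gamma> b g j (Node Fat {#}) = g j"
  "Phi s a \<gamma> b g j (Node Fat {#\<tau>#}) = g j * Phi_bar s a \<gamma> j \<tau>"
  by (simp_all add: Phi_def)

lemma Phi_bar_simps:
  "Phi_bar s a \<gamma> j (Node Meagre {#}) = (\<Sum>k=1..s. a j k)"
  "Phi_bar s a \<gamma> j (Node Meagre ts) = (\<Sum>k=1..s. a j k * (\<Prod>\<tau>\<in>#ts. Phi_bar s a \<gamma> k \<tau>))"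
  "Phi_bar s a \<gamma> j (Node Fat {#}) = (\<Sum>k=1..s. \<gamma> j k)"
  "Phi_bar s a \<gamma> j (Node Fat {#\<tau>#}) = (\<Sum>k=1..s. \<gamma> j k * Phi_bar s a \<gamma> k \<tau>)"
  by (simp_all add: Phi_bar_def image_mset.compositionality comp_def)

lemma Phi_bar_aux_theta:
  "Phi_bar_aux s a \<gamma> (theta q ts) True j = \<gamma> j j ^ (q + 1) * (\<Prod>\<tau>\<in>#ts. Phi_bar s a \<gamma> j \<tau>)"
  by (induction q)
    (simp_all add: theta_def Phi_bar_def image_mset.compositionality comp_def)

lemma Phi_bar_theta:
  assumes "q \<ge> 1"
  shows "Phi_bar s a \<gamma> j (theta q {#}) = \<gamma> j j ^ (q + 1)"
    and "Phi_bar s a \<gamma> j (theta q {#\<tau>#}) = \<gamma> j j ^ (q + 1) * Phi_bar s a \<gamma> j \<tau>"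
proof -
  obtain r where q: "q = Suc r"
    using assms by (cases q) auto
  have "Phi_bar s a \<gamma> j (theta q ts) = \<gamma> j j * Phi_bar_aux s a \<gamma> (theta r ts) True j" for ts
    by (simp add: q theta_def Phi_bar_def)
  then show "Phi_bar s a \<gamma> j (theta q {#}) = \<gamma> j j ^ (q + 1)"
    and "Phi_bar s a \<gamma> j (theta q {#\<tau>#}) = \<gamma> j j ^ (q + 1) * Phi_bar s a \<gamma> j \<tau>"
    by (simp_all only: Phi_bar_aux_theta) (simp_all add: q)
qed

lemma lw2_subtree_square_cases:
  assumes "lw2_subtree \<tau>" "root \<tau> = Square"
  obtains q ts where "q \<ge> 1" "size ts \<le> 1" "\<forall>\<tau>'\<in>#ts. lw2_subtree \<tau>'" "\<tau> = theta q ts"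
proof -
  have "\<exists>q ts. q \<ge> 1 \<and> size ts \<le> 1 \<and> (\<forall>\<tau>'\<in>#ts. lw2_subtree \<tau>') \<and> \<tau> = theta q ts"
    using assms
  proof (induction rule: lw2_subtree.induct)
    case (square \<tau>)
    show ?case
    proof (cases "root \<tau> = Square")
      case True
      then obtain q ts where "size ts \<le> 1" "\<forall>\<tau>'\<in>#ts. lw2_subtree \<tau>'" "\<tau> = theta q ts"
        using square.IH by blast
      then show ?thesis
        by (intro exI[of _ "Suc q"] exI[of _ ts]) (simp add: theta_def)
    next
      case False
      then have fat: "root \<tau> = Fat"
        using square.hyps by auto
      from \<open>lw2_subtree \<tau>\<close> fat obtain ts where
        "\<tau> = Node Fat ts" "size ts \<le> 1" "\<forall>\<tau>'\<in>#ts. lw2_subtree \<tau>'"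
        by (cases rule: lw2_subtree.cases) auto
      then show ?thesis
        by (intro exI[of _ 1] exI[of _ ts]) (simp add: theta_def)
    qed
  qed auto
  then show ?thesis
    using that by blast
qed

end

theory Submission
  imports Defs
begin

text \<open>
  The order conditions are sufficient because the exact solution, the stages and the update all
  have expansions in \<open>h\<close> that are sums over the same trees with the same elementary
  differentials, so that only the weights have to be compared (\<open>exact_jet\<close>, \<open>stage_jet\<close>,
  \<open>update_jet\<close>). The expansions are obtained order by order. If a curve agrees with a tree
  series up to \<open>O(h ^ n)\<close>, then Taylor's formula and multiplying out show the same for the vector
  field along the curve, where the new trees have a meagre root (\<open>field_jet\<close>); applying a Taylor
  coefficient of the matrix puts a chain of squares that ends in a fat vertex on top of
  them (\<open>matrix_jet\<close>). The differential equation gains one order by integration, and the stage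
  equations gain one since each stage on their right-hand side is multiplied by \<open>h\<close>.
  The weights arise by the same recursion as the elementary weights of the method, and
  for the exact solution integration divides by the number of vertices, which gives
  \<open>1 / \<gamma>(\<tau>)\<close> on meagre trees and 0 on all others.

  The sums run over trees with ordered children and with a component index at every vertex.
  Thus the coefficients are plain products of derivatives and inverse factorials, with symmetry
  factors hidden in the repeated orderings of the same tree. Sufficiency only asks that
  equal weights give equal sums, so the orderings never have to be collected.

  The order conditions are necessary because for each tree \<open>\<tau>\<close> there is a polynomial problem, with
  one component for each subtree, in which the component of \<open>\<tau>\<close> sees no other tree. There
  the stages and the solution are known in closed form, and the local error in
  this component is \<open>h ^ rho \<tau>\<close> times the defect of the order condition
  (\<open>order_conditions_necessary\<close>).
\<close>


section \<open>Agreement up to a power of the step size\<close>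

text \<open>
  Only the coefficients of \<open>h ^ 0\<close>, ..., \<open>h ^ (n - 1)\<close> are compared, so \<open>n = 0\<close> just says that
  the difference is bounded near 0. The filter leaves out \<open>h = 0\<close> itself.
\<close>

definition jet_eq :: "nat \<Rightarrow> (real \<Rightarrow> real) \<Rightarrow> (real \<Rightarrow> real) \<Rightarrow> bool" where
  "jet_eq n f g \<longleftrightarrow> (\<lambda>h. f h - g h) \<in> O[at 0](\<lambda>h. h ^ n)"

lemma jet_eq_refl [simp]: "jet_eq n f f"
  by (simp add: jet_eq_def)

lemma jet_eq_sym: "jet_eq n f g \<Longrightarrow> jet_eq n g f"
  unfolding jet_eq_def by (subst landau_o.big.uminus_in_iff [symmetric]) simp

lemma jet_eq_add:
  assumes "jet_eq n f f'" "jet_eq n g g'"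
  shows "jet_eq n (\<lambda>h. f h + g h) (\<lambda>h. f' h + g' h)"
  using sum_in_bigo(1)[OF assms[unfolded jet_eq_def]]
  by (simp add: jet_eq_def algebra_simps)

lemma jet_eq_trans [trans]: "jet_eq n f g \<Longrightarrow> jet_eq n g k \<Longrightarrow> jet_eq n f k"
  unfolding jet_eq_def by (drule (1) sum_in_bigo(1)) simp

lemma jet_eq_diff:
  assumes "jet_eq n f f'" "jet_eq n g g'"
  shows "jet_eq n (\<lambda>h. f h - g h) (\<lambda>h. f' h - g' h)"
  using sum_in_bigo(2)[OF assms[unfolded jet_eq_def]]
  by (simp add: jet_eq_def algebra_simps)

lemma jet_eq_sum:
  assumes "\<And>x. x \<in> A \<Longrightarrow> jet_eq n (f x) (g x)"
  shows "jet_eq n (\<lambda>h. \<Sum>x\<in>A. f x h) (\<lambda>h. \<Sum>x\<in>A. g x h)"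
  using big_sum_in_bigo[of A "\<lambda>x h. f x h - g x h"] assms
  by (simp add: jet_eq_def sum_subtractf)

lemma jet_eq_cmult:
  assumes "jet_eq n f g"
  shows "jet_eq n (\<lambda>h. c * f h) (\<lambda>h. c * g h)"
  using assms by (cases "c = 0") (simp_all add: jet_eq_def right_diff_distrib [symmetric])

lemma bigo_cmult: "f \<in> O[at 0](g) \<Longrightarrow> (\<lambda>h. c * f h) \<in> O[at (0::real)](g)" for c :: real
  by (cases "c = 0") simp_all

lemma jet_eq_power_mult:
  assumes "jet_eq n f g"
  shows "jet_eq (k + n) (\<lambda>h. h ^ k * f h) (\<lambda>h. h ^ k * g h)"
  using landau_o.big.mult_left[OF assms[unfolded jet_eq_def], of "\<lambda>h. h ^ k"]
  by (simp add: jet_eq_def right_diff_distrib power_add)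

lemma power_bigo_power_at_0:
  assumes "n \<le> k"
  shows "(\<lambda>h::real. h ^ k) \<in> O[at 0](\<lambda>h. h ^ n)"
proof -
  have "\<forall>\<^sub>F h in at (0::real). \<bar>h\<bar> < 1"
    by (auto simp: eventually_at intro!: exI[of _ 1])
  then have "\<forall>\<^sub>F h in at (0::real). norm (h ^ k) \<le> 1 * norm (h ^ n)"
    by eventually_elim (use assms in \<open>auto simp: power_abs intro!: power_decreasing\<close>)
  then show ?thesis
    by (rule bigoI)
qed

lemma jet_eq_weaken: "jet_eq n f g \<Longrightarrow> m \<le> n \<Longrightarrow> jet_eq m f g"
  unfolding jet_eq_def by (rule landau_o.big_trans, assumption) (rule power_bigo_power_at_0)

lemma jet_eq_cong:
  assumes "jet_eq n f g" "\<forall>\<^sub>F h in at 0. f h = f' h" "\<forall>\<^sub>F h in at 0. g h = g' h"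
  shows "jet_eq n f' g'"
proof -
  have "\<forall>\<^sub>F h in at 0. f h - g h = f' h - g' h"
    using assms(2,3) by eventually_elim simp
  from landau_o.big.in_cong[OF this] assms(1) show ?thesis
    by (simp add: jet_eq_def)
qed

lemma jet_eq_power_0:
  assumes "n \<le> k"
  shows "jet_eq n (\<lambda>h. c * h ^ k) (\<lambda>_. 0)"
  using power_bigo_power_at_0[OF assms] by (cases "c = 0") (simp_all add: jet_eq_def)

lemma jet_eq_truncate:
  assumes "finite A" "B \<subseteq> A" "\<And>x. x \<in> A - B \<Longrightarrow> n \<le> k x"
  shows "jet_eq n (\<lambda>h. \<Sum>x\<in>A. c x * h ^ k x) (\<lambda>h. \<Sum>x\<in>B. c x * h ^ k x)"
proof -
  have "jet_eq n (\<lambda>h. \<Sum>x\<in>A - B. c x * h ^ k x) (\<lambda>h. \<Sum>x\<in>A - B. 0)"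
    by (intro jet_eq_sum jet_eq_power_0 assms)
  then show ?thesis
    using assms(1,2) by (simp add: jet_eq_def sum_diff)
qed

lemma bounded_of_tendsto_at_0:
  assumes "(f \<longlongrightarrow> (c::real)) (at (0::real))"
  shows "f \<in> O[at 0](\<lambda>_. 1)"
  by (rule bigoI_tendsto[of _ _ c]) (use assms in auto)

lemma jet_eq_tendsto:
  assumes "jet_eq (Suc n) f g" "(g \<longlongrightarrow> c) (at 0)"
  shows "(f \<longlongrightarrow> c) (at 0)"
proof -
  have "(\<lambda>h. f h - g h) \<in> O[at 0](\<lambda>h. h)"
    using jet_eq_weaken[OF assms(1), of 1] by (simp add: jet_eq_def)
  also have "(\<lambda>h::real. h) \<in> o[at 0](\<lambda>_. 1)"
    by (rule smalloI_tendsto) (auto intro!: tendsto_eq_intros)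
  finally have "((\<lambda>h. f h - g h) \<longlongrightarrow> 0) (at 0)"
    using smalloD_tendsto by fastforce
  from tendsto_add[OF this assms(2)] show ?thesis
    by simp
qed

lemma jet_eq_bounded:
  assumes "jet_eq n f g" "g \<in> O[at 0](\<lambda>_. 1)"
  shows "f \<in> O[at 0](\<lambda>_. 1)"
proof -
  have "(\<lambda>h. f h - g h) \<in> O[at 0](\<lambda>_. 1)"
    using jet_eq_weaken[OF assms(1), of 0] by (simp add: jet_eq_def)
  from sum_in_bigo(1)[OF this assms(2)] show ?thesis
    by simp
qed

text \<open>
  A perturbation of one factor is multiplied by the other one, so the factors have to be bounded.
\<close>

lemma jet_eq_mult:
  assumes "jet_eq n f f'" "jet_eq n g g'"
    and "f' \<in> O[at 0](\<lambda>_. 1)" "g' \<in> O[at 0](\<lambda>_. 1)"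
  shows "jet_eq n (\<lambda>h. f h * g h) (\<lambda>h. f' h * g' h)"
proof -
  have f: "f \<in> O[at 0](\<lambda>_. 1)"
    by (rule jet_eq_bounded) fact+
  have "(\<lambda>h. (f h - f' h) * g' h) \<in> O[at 0](\<lambda>h. h ^ n * 1)"
    by (rule landau_o.big.mult) (use assms in \<open>auto simp: jet_eq_def\<close>)
  moreover have "(\<lambda>h. f h * (g h - g' h)) \<in> O[at 0](\<lambda>h. 1 * h ^ n)"
    by (rule landau_o.big.mult) (use assms f in \<open>auto simp: jet_eq_def\<close>)
  ultimately have "(\<lambda>h. (f h - f' h) * g' h + f h * (g h - g' h)) \<in> O[at 0](\<lambda>h. h ^ n)"
    by (intro sum_in_bigo(1)) simp_all
  then show ?thesis
    by (simp add: jet_eq_def algebra_simps)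
qed

lemma bounded_prod_list:
  assumes "\<And>x. x \<in> set w \<Longrightarrow> f x \<in> O[at (0::real)](\<lambda>_. 1::real)"
  shows "(\<lambda>h. prod_list (map (\<lambda>x. f x h) w)) \<in> O[at 0](\<lambda>_. 1)"
  using assms
proof (induction w)
  case (Cons x w)
  have "(\<lambda>h. f x h * prod_list (map (\<lambda>x. f x h) w)) \<in> O[at 0](\<lambda>_. 1 * 1)"
    by (rule landau_o.big.mult) (use Cons in auto)
  then show ?case by simp
qed simp

lemma jet_eq_prod_list:
  assumes "\<And>x. x \<in> set w \<Longrightarrow> jet_eq n (f x) (g x)"
    and "\<And>x. x \<in> set w \<Longrightarrow> g x \<in> O[at 0](\<lambda>_. 1)"
  shows "jet_eq n (\<lambda>h. prod_list (map (\<lambda>x. f x h) w)) (\<lambda>h. prod_list (map (\<lambda>x. g x h) w))"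
  using assms
proof (induction w)
  case (Cons x w)
  have "jet_eq n (\<lambda>h. f x h * prod_list (map (\<lambda>x. f x h) w))
      (\<lambda>h. g x h * prod_list (map (\<lambda>x. g x h) w))"
    by (intro jet_eq_mult bounded_prod_list) (use Cons in auto)
  then show ?case by simp
qed simp

text \<open>
  Integration gains one order of agreement: the mean value theorem writes the difference at \<open>h\<close>
  as \<open>h\<close> times the difference of the derivatives at some point between 0 and \<open>h\<close>.
\<close>

lemma jet_eq_antiderivative:
  assumes "\<delta> > 0"
    and f: "\<And>h. \<bar>h\<bar> < \<delta> \<Longrightarrow> (f has_real_derivative f' h) (at h)"
    and g: "\<And>h. \<bar>h\<bar> < \<delta> \<Longrightarrow> (g has_real_derivative g' h) (at h)"
    and "f 0 = g 0" "jet_eq n f' g'"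
  shows "jet_eq (Suc n) f g"
proof -
  obtain c where c: "\<forall>\<^sub>F h in at 0. \<bar>f' h - g' h\<bar> \<le> c * \<bar>h\<bar> ^ n"
    using assms(5) unfolding jet_eq_def bigo_def by (auto simp: power_abs)
  then obtain \<epsilon> where \<epsilon>: "\<epsilon> > 0"
    "\<And>h. h \<noteq> 0 \<Longrightarrow> \<bar>h\<bar> < \<epsilon> \<Longrightarrow> \<bar>f' h - g' h\<bar> \<le> c * \<bar>h\<bar> ^ n"
    unfolding eventually_at by (auto simp: dist_real_def)
  define D where "D h = f h - g h" for h
  have D: "(D has_real_derivative (f' h - g' h)) (at h)" if "\<bar>h\<bar> < \<delta>" for h
    unfolding D_def using f[OF that] g[OF that] by (rule DERIV_diff)
  have D0: "D 0 = 0"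
    using assms(4) by (simp add: D_def)
  have c0: "c \<ge> 0"
  proof -
    have "0 \<le> c * \<bar>\<epsilon> / 2\<bar> ^ n"
      using \<epsilon>(2)[of "\<epsilon> / 2"] \<epsilon>(1) by (smt (verit) field_sum_of_halves)
    then show ?thesis
      using \<epsilon>(1) by (metis abs_of_pos half_gt_zero zero_le_mult_iff zero_less_power not_less)
  qed
  have bound: "\<bar>D h\<bar> \<le> c * \<bar>h\<bar> ^ Suc n" if h: "h \<noteq> 0" "\<bar>h\<bar> < min \<delta> \<epsilon>" for h
  proof -
    obtain z where z: "z \<noteq> 0" "\<bar>z\<bar> \<le> \<bar>h\<bar>" "D h = h * (f' z - g' z)"
    proof (cases "h > 0")
      case True
      obtain z where "0 < z" "z < h" "D h - D 0 = (h - 0) * (f' z - g' z)"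
        using MVT2[of 0 h D "\<lambda>z. f' z - g' z"] D True h by auto
      then show ?thesis
        using that[of z] D0 by auto
    next
      case False
      obtain z where "h < z" "z < 0" "D 0 - D h = (0 - h) * (f' z - g' z)"
        using MVT2[of h 0 D "\<lambda>z. f' z - g' z"] D False h by auto
      then show ?thesis
        using that[of z] D0 by auto
    qed
    have "\<bar>f' z - g' z\<bar> \<le> c * \<bar>z\<bar> ^ n"
      using \<epsilon>(2) z h by auto
    also have "\<dots> \<le> c * \<bar>h\<bar> ^ n"
      by (intro mult_left_mono power_mono z c0) auto
    finally have "\<bar>h\<bar> * \<bar>f' z - g' z\<bar> \<le> \<bar>h\<bar> * (c * \<bar>h\<bar> ^ n)"
      by (rule mult_left_mono) simp
    then show ?thesis
      by (simp add: z(3) abs_mult mult_ac)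
  qed
  have "\<forall>\<^sub>F h in at 0. norm (D h) \<le> c * norm (h ^ Suc n)"
    unfolding eventually_at
  proof (intro exI conjI ballI impI)
    show "min \<delta> \<epsilon> > 0"
      using \<epsilon>(1) assms(1) by simp
  qed (use bound in \<open>auto simp: dist_real_def power_abs abs_mult\<close>)
  then show ?thesis
    unfolding jet_eq_def D_def by (rule bigoI)
qed


section \<open>Taylor expansion of smooth functions\<close>

declare iterated_partial.simps [simp del]

lemma continuous_on_Euclidean_space:
  "continuous_map (Euclidean_space N) euclideanreal f \<longleftrightarrow>
     continuous_on (topspace (Euclidean_space N)) f"
  by (simp add: topspace_Euclidean_space Euclidean_space_def euclidean_product_topology)

lemma continuous_map_Euclidean_tendsto:
  assumes "continuous_map (Euclidean_space N) euclideanreal f"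
    and "x \<in> topspace (Euclidean_space N)"
    and ev: "\<forall>\<^sub>F h in G. c h \<in> topspace (Euclidean_space N)"
    and lim: "\<And>i. i < N \<Longrightarrow> ((\<lambda>h. c h i) \<longlongrightarrow> x i) G"
  shows "((\<lambda>h. f (c h)) \<longlongrightarrow> f x) G"
proof -
  let ?E = "topspace (Euclidean_space N)"
  have "((\<lambda>h. c h i) \<longlongrightarrow> x i) G" for i
  proof (cases "i < N")
    case False
    then have "\<forall>\<^sub>F h in G. c h i = x i"
      using ev assms(2) by (auto elim!: eventually_mono simp: topspace_Euclidean_space)
    then show ?thesis
      by (rule tendsto_eventually)
  qed (rule lim)
  then have c: "(c \<longlongrightarrow> x) G"
    using limitin_componentwise[of "\<lambda>_::nat. euclidean :: real topology" UNIV c x G]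
    by (auto simp: euclidean_product_topology)
  have "continuous_on ?E f"
    using assms(1) by (simp add: continuous_on_Euclidean_space)
  then show ?thesis
    by (rule continuous_on_tendsto_compose) (use c assms(2) ev in auto)
qed

text \<open>The increment may have either sign or vanish, since it is \<open>s * z k\<close> below.\<close>

lemma MVT_any_order:
  assumes "\<And>x::real. (f has_real_derivative f' x) (at x)"
  shows "\<exists>z. \<bar>z - a\<bar> \<le> \<bar>b - a\<bar> \<and> f b - f a = (b - a) * f' z"
proof (cases a b rule: linorder_cases)
  case less
  with MVT2[of a b f f'] assms show ?thesis by force
next
  case greater
  with MVT2[of b a f f'] assms obtain z where "b < z" "z < a" "f a - f b = (a - b) * f' z"
    by blast
  then show ?thesis
    by (intro exI[of _ z]) (auto simp: algebra_simps)
qed auto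

definition euc :: "nat \<Rightarrow> (nat \<Rightarrow> real) set" where
  "euc N = topspace (Euclidean_space N)"

lemma euc_iff: "x \<in> euc N \<longleftrightarrow> (\<forall>i\<ge>N. x i = 0)"
  by (simp add: euc_def topspace_Euclidean_space)

lemma smooth_fun_partial:
  assumes "smooth_fun N f" "set w \<subseteq> {..<N}" "i < N" "x \<in> euc N"
  shows "((\<lambda>t. iterated_partial w f (x(i := t))) has_real_derivative
           iterated_partial (i # w) f (x(i := u))) (at u)"
proof -
  have "x(i := u) \<in> euc N"
    using assms by (auto simp: euc_iff)
  then have "(\<lambda>t. iterated_partial w f (x(i := u, i := t))) field_differentiable (at u)"
    using assms unfolding smooth_fun_def euc_def by (metis fun_upd_same)
  then have "((\<lambda>t. iterated_partial w f (x(i := u, i := t))) has_real_derivative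
      deriv (\<lambda>t. iterated_partial w f (x(i := u, i := t))) u) (at u)"
    using DERIV_deriv_iff_field_differentiable by blast
  then show ?thesis by (simp add: iterated_partial.simps)
qed

lemma smooth_fun_tendsto:
  assumes "smooth_fun N f" "set w \<subseteq> {..<N}" "x \<in> euc N"
    and "\<forall>\<^sub>F h in G. c h \<in> euc N"
    and "\<And>i. i < N \<Longrightarrow> ((\<lambda>h. c h i) \<longlongrightarrow> x i) G"
  shows "((\<lambda>h. iterated_partial w f (c h)) \<longlongrightarrow> iterated_partial w f x) G"
  by (rule continuous_map_Euclidean_tendsto[where N = N])
    (use assms in \<open>auto simp: smooth_fun_def euc_def\<close>)

text \<open>
  Continuity of the partial derivatives gives the chain rule along a line: the increment is
  telescoped over the coordinates and the mean value theorem is applied in each of them.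
\<close>

lemma derivative_along_line_at_0:
  assumes sm: "smooth_fun N f" and w: "set w \<subseteq> {..<N}" and p: "p \<in> euc N" and z: "z \<in> euc N"
  shows "((\<lambda>s. iterated_partial w f (\<lambda>i. p i + s * z i)) has_real_derivative
           (\<Sum>i<N. z i * iterated_partial (i # w) f p)) (at 0)"
proof -
  let ?g = "iterated_partial w f"
  \<comment> \<open>\<open>c s\<close> is an edge path from \<open>p\<close> to \<open>p + s z\<close> that changes one coordinate at a time.\<close>
  define c where "c s k = (\<lambda>i. if i < k then p i + s * z i else p i)" for s :: real and k
  have c_euc: "c s k \<in> euc N" for s k
    using p z by (auto simp: c_def euc_iff)
  have "\<forall>s k. \<exists>u. k < N \<longrightarrow> \<bar>u - p k\<bar> \<le> \<bar>s * z k\<bar> \<and>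
      ?g (c s (Suc k)) - ?g (c s k) = s * z k * iterated_partial (k # w) f ((c s k)(k := u))"
  proof (intro allI)
    fix s k
    show "\<exists>u. k < N \<longrightarrow> \<bar>u - p k\<bar> \<le> \<bar>s * z k\<bar> \<and>
      ?g (c s (Suc k)) - ?g (c s k) = s * z k * iterated_partial (k # w) f ((c s k)(k := u))"
    proof (cases "k < N")
      case True
      have "(c s k)(k := p k + s * z k) = c s (Suc k)" "(c s k)(k := p k) = c s k"
        by (auto simp: c_def fun_eq_iff)
      then show ?thesis
        using MVT_any_order[OF smooth_fun_partial[OF sm w True c_euc[of s k]],
            of "p k" "p k + s * z k"]
        by simp
    qed simp
  qed
  then obtain u where u:
    "\<And>s k. k < N \<Longrightarrow> \<bar>u s k - p k\<bar> \<le> \<bar>s * z k\<bar>"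
    "\<And>s k. k < N \<Longrightarrow> ?g (c s (Suc k)) - ?g (c s k) =
        s * z k * iterated_partial (k # w) f ((c s k)(k := u s k))"
    unfolding choice_iff by blast
  have telescope: "?g (\<lambda>i. p i + s * z i) - ?g p =
      (\<Sum>k<N. s * z k * iterated_partial (k # w) f ((c s k)(k := u s k)))" for s
  proof -
    have "c s N = (\<lambda>i. p i + s * z i)" "c s 0 = p"
      using z by (auto simp: c_def fun_eq_iff euc_iff)
    then show ?thesis
      using sum_lessThan_telescope[of "\<lambda>k. ?g (c s k)" N] u(2) by simp
  qed
  have lim: "((\<lambda>s. iterated_partial (k # w) f ((c s k)(k := u s k))) \<longlongrightarrow>
      iterated_partial (k # w) f p) (at 0)" if k: "k < N" for k
  proof (rule smooth_fun_tendsto[OF sm _ p])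
    show "\<forall>\<^sub>F s in at 0. (c s k)(k := u s k) \<in> euc N"
      using c_euc k by (auto simp: euc_iff)
    have *: "((\<lambda>s. \<bar>s * z k\<bar>) \<longlongrightarrow> 0) (at 0)"
      by (auto intro!: tendsto_eq_intros)
    have "((\<lambda>s. u s k - p k) \<longlongrightarrow> 0) (at 0)"
      by (rule Lim_null_comparison[OF _ *]) (use u(1)[OF k] in auto)
    then have "((\<lambda>s. u s k) \<longlongrightarrow> p k) (at 0)"
      by (simp add: LIM_zero_iff)
    moreover have "((\<lambda>s. c s k i) \<longlongrightarrow> p i) (at 0)" for i
      by (cases "i < k") (auto simp: c_def intro!: tendsto_eq_intros)
    ultimately show "((\<lambda>s. ((c s k)(k := u s k)) i) \<longlongrightarrow> p i) (at 0)" for i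
      by (cases "i = k") auto
  qed (use w k in auto)
  have "((\<lambda>s. (\<Sum>k<N. z k * iterated_partial (k # w) f ((c s k)(k := u s k)))) \<longlongrightarrow>
      (\<Sum>k<N. z k * iterated_partial (k # w) f p)) (at 0)"
    by (intro tendsto_sum tendsto_mult tendsto_const lim) auto
  moreover have "\<forall>\<^sub>F s in at 0.
      (\<Sum>k<N. z k * iterated_partial (k # w) f ((c s k)(k := u s k))) =
      (?g (\<lambda>i. p i + s * z i) - ?g p) / s"
    unfolding telescope
    by (auto simp: eventually_at sum_divide_distrib intro!: exI[of _ 1])
  ultimately show ?thesis
    unfolding has_field_derivative_iff by (auto intro: Lim_transform_eventually)
qed

lemma derivative_along_line:
  assumes "smooth_fun N f" "set w \<subseteq> {..<N}" "x \<in> euc N" "z \<in> euc N"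
  shows "((\<lambda>s. iterated_partial w f (\<lambda>i. x i + s * z i)) has_real_derivative
           (\<Sum>i<N. z i * iterated_partial (i # w) f (\<lambda>i. x i + t * z i))) (at t)"
proof -
  have "(\<lambda>i. x i + t * z i) \<in> euc N"
    using assms by (auto simp: euc_iff)
  note derivative_along_line_at_0[OF assms(1,2) this assms(4)]
  then have "((\<lambda>s. iterated_partial w f (\<lambda>i. x i + (s + t) * z i)) has_real_derivative
      (\<Sum>i<N. z i * iterated_partial (i # w) f (\<lambda>i. x i + t * z i))) (at 0)"
    by (simp add: algebra_simps)
  then show ?thesis
    using DERIV_shift[of "\<lambda>s. iterated_partial w f (\<lambda>i. x i + s * z i)" _ 0 t] by simp
qed

text \<open>
  The words of length k over the coordinates index all k-fold partial derivatives, with a separate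
  term for each order of differentiation. So the k-th derivative along a line is a plain sum
  over the words, and the only factor in Taylor's formula is \<open>1 / fact k\<close>.
\<close>

definition words :: "nat \<Rightarrow> nat \<Rightarrow> nat list set" where
  "words N k = {w. set w \<subseteq> {..<N} \<and> length w = k}"

lemma finite_words [simp]: "finite (words N k)"
  unfolding words_def by (rule finite_lists_length_eq) simp

lemma words_0: "words N 0 = {[]}"
  by (auto simp: words_def)

lemma words_Suc: "words N (Suc k) = (\<lambda>(i, w). i # w) ` ({..<N} \<times> words N k)"
  by (auto simp: words_def length_Suc_conv image_iff)

lemma sum_words_Suc: "(\<Sum>w\<in>words N (Suc k). f w) = (\<Sum>w\<in>words N k. \<Sum>i<N. f (i # w))"
proof -
  have "(\<Sum>w\<in>words N (Suc k). f w) = (\<Sum>(i, w)\<in>{..<N} \<times> words N k. f (i # w))"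
    unfolding words_Suc by (subst sum.reindex) (auto simp: inj_on_def case_prod_unfold)
  then show ?thesis
    by (simp add: sum.cartesian_product [symmetric] sum.swap[of _ "words N k"])
qed

lemma smooth_fun_Taylor:
  assumes sm: "smooth_fun N f" and x: "x \<in> euc N" and z: "z \<in> euc N"
  shows "\<exists>\<theta>. \<bar>\<theta>\<bar> \<le> 1 \<and> f (\<lambda>i. x i + z i) =
    (\<Sum>k<n. (\<Sum>w\<in>words N k. iterated_partial w f x * prod_list (map z w)) / fact k) +
    (\<Sum>w\<in>words N n. iterated_partial w f (\<lambda>i. x i + \<theta> * z i) * prod_list (map z w)) / fact n"
proof -
  define D where "D k t =
    (\<Sum>w\<in>words N k. iterated_partial w f (\<lambda>i. x i + t * z i) * prod_list (map z w))" for k t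
  have "(D k has_real_derivative D (Suc k) t) (at t)" for k t
  proof -
    have "D (Suc k) t = (\<Sum>w\<in>words N k.
        (\<Sum>i<N. z i * iterated_partial (i # w) f (\<lambda>i. x i + t * z i)) * prod_list (map z w))"
      unfolding D_def sum_words_Suc by (simp add: sum_distrib_left sum_distrib_right mult_ac)
    then show ?thesis
      unfolding D_def
      by (simp) (intro DERIV_sum DERIV_cmult_right
          derivative_along_line sm x z, auto simp: words_def)
  qed
  then show ?thesis
    using Maclaurin_all_le[of D "D 0" 1 n] by (simp add: D_def words_0 iterated_partial.simps)
qed

text \<open>
  Along a curve through \<open>x\<close> that moves by \<open>O(h)\<close>, the Taylor polynomial of degree below \<open>n\<close>
  gives the value up to \<open>O(h^n)\<close>: the derivatives in the remainder are taken at points that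
  tend to \<open>x\<close>, so they stay bounded.
\<close>

lemma jet_eq_Taylor:
  assumes sm: "smooth_fun N f" and x: "x \<in> euc N"
    and Y: "\<forall>\<^sub>F h in at 0. Y h \<in> euc N"
    and near: "\<And>l. l < N \<Longrightarrow> jet_eq 1 (\<lambda>h. Y h l) (\<lambda>_. x l)"
  shows "jet_eq n (\<lambda>h. f (Y h))
    (\<lambda>h. \<Sum>k<n. (\<Sum>w\<in>words N k. iterated_partial w f x *
        prod_list (map (\<lambda>l. Y h l - x l) w)) / fact k)"
proof -
  let ?T = "\<lambda>h. \<Sum>k<n. (\<Sum>w\<in>words N k. iterated_partial w f x *
        prod_list (map (\<lambda>l. Y h l - x l) w)) / fact k"
  \<comment> \<open>Cutting off at \<open>N\<close> makes \<open>z h\<close> a point of the space also where \<open>Y h\<close> is not one.\<close>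
  define z where "z h = (\<lambda>l. if l < N then Y h l - x l else 0)" for h
  have z: "z h \<in> euc N" for h
    by (auto simp: z_def euc_iff)
  have "\<forall>h. \<exists>\<theta>. \<bar>\<theta>\<bar> \<le> 1 \<and> f (\<lambda>i. x i + z h i) =
    (\<Sum>k<n. (\<Sum>w\<in>words N k. iterated_partial w f x * prod_list (map (z h) w)) / fact k) +
    (\<Sum>w\<in>words N n. iterated_partial w f (\<lambda>i. x i + \<theta> * z h i) * prod_list (map (z h) w)) / fact n"
    using smooth_fun_Taylor[OF sm x z] by blast
  then obtain \<theta> where \<theta>: "\<And>h. \<bar>\<theta> h\<bar> \<le> 1" "\<And>h. f (\<lambda>i. x i + z h i) =
    (\<Sum>k<n. (\<Sum>w\<in>words N k. iterated_partial w f x * prod_list (map (z h) w)) / fact k) +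
    (\<Sum>w\<in>words N n. iterated_partial w f (\<lambda>i. x i + \<theta> h * z h i) * prod_list (map (z h) w)) / fact n"
    unfolding choice_iff by blast
  have zw: "map (z h) w = map (\<lambda>l. Y h l - x l) w" if "w \<in> words N k" for h w k
    using that by (auto simp: z_def words_def)
  have zO: "(\<lambda>h. z h l) \<in> O[at 0](\<lambda>h. h)" for l
    using near[of l] by (cases "l < N") (simp_all add: jet_eq_def z_def)
  have z0: "((\<lambda>h. z h l) \<longlongrightarrow> 0) (at 0)" for l
  proof -
    have "jet_eq (Suc 0) (\<lambda>h. z h l) (\<lambda>_. 0)"
      using zO[of l] by (simp add: jet_eq_def)
    then show ?thesis
      by (rule jet_eq_tendsto) simp
  qed
  have prod: "(\<lambda>h. prod_list (map (z h) w)) \<in> O[at 0](\<lambda>h. h ^ length w)" for w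
    by (induction w) (auto intro!: landau_o.big.mult zO)
  have "(\<lambda>h. (\<Sum>w\<in>words N n. iterated_partial w f (\<lambda>i. x i + \<theta> h * z h i) *
      prod_list (map (z h) w)) / fact n) \<in> O[at 0](\<lambda>h. h ^ n)"
  proof -
    have "(\<lambda>h. iterated_partial w f (\<lambda>i. x i + \<theta> h * z h i) * prod_list (map (z h) w))
        \<in> O[at 0](\<lambda>h. 1 * h ^ n)" if w: "w \<in> words N n" for w
    proof (rule landau_o.big.mult)
      show "(\<lambda>h. iterated_partial w f (\<lambda>i. x i + \<theta> h * z h i)) \<in> O[at 0](\<lambda>_. 1)"
      proof (rule bounded_of_tendsto_at_0, rule smooth_fun_tendsto[OF sm _ x])
        show "\<forall>\<^sub>F h in at 0. (\<lambda>i. x i + \<theta> h * z h i) \<in> euc N"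
          using x z by (auto simp: euc_iff)
        have "((\<lambda>h. \<theta> h * z h i) \<longlongrightarrow> 0) (at 0)" for i
          by (rule Lim_null_comparison[OF _ tendsto_rabs_zero[OF z0[of i]]])
            (simp add: abs_mult mult_left_le_one_le \<theta>(1))
        from tendsto_add[OF tendsto_const this]
        show "((\<lambda>h. x i + \<theta> h * z h i) \<longlongrightarrow> x i) (at 0)" for i
          by fastforce
      qed (use w in \<open>auto simp: words_def\<close>)
      show "(\<lambda>h. prod_list (map (z h) w)) \<in> O[at 0](\<lambda>h. h ^ n)"
        using prod[of w] w by (simp add: words_def)
    qed
    then show ?thesis
      by (auto intro!: big_sum_in_bigo)
  qed
  then have "jet_eq n (\<lambda>h. f (\<lambda>i. x i + z h i)) (\<lambda>h. \<Sum>k<n. (\<Sum>w\<in>words N k.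
      iterated_partial w f x * prod_list (map (z h) w)) / fact k)"
    unfolding jet_eq_def \<theta>(2) by simp
  moreover have "\<forall>\<^sub>F h in at 0. f (\<lambda>i. x i + z h i) = f (Y h)"
    using Y
  proof eventually_elim
    case (elim h)
    have "(\<lambda>i. x i + z h i) = Y h"
      using elim x by (auto simp: z_def euc_iff fun_eq_iff)
    then show ?case by simp
  qed
  ultimately show ?thesis
    by (rule jet_eq_cong) (simp add: zw)
qed


section \<open>Ordered trees with labelled components\<close>

lemma theta_simps [simp]:
  "theta 0 ts = Node Fat ts"
  "theta (Suc q) ts = Node Square {#theta q ts#}"
  by (simp_all add: theta_def)

lemma rho_theta [simp]: "rho (theta q ts) = q + 1 + sum_mset (image_mset rho ts)"
  by (induction q) simp_all

lemma root_theta: "root (theta q ts) = (if q = 0 then Fat else Square)"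
  by (cases q) simp_all

lemma lw2_subtree_theta:
  assumes "size ts \<le> 1" "\<forall>\<tau>\<in>#ts. lw2_subtree \<tau>"
  shows "lw2_subtree (theta q ts)"
  using assms by (induction q) (auto intro!: lw2_subtree.intros simp: root_theta split: if_splits)

lemma Phi_bar_Meagre:
  "Phi_bar s a \<gamma> j (Node Meagre ts) = (\<Sum>k=1..s. a j k * (\<Prod>\<tau>\<in>#ts. Phi_bar s a \<gamma> k \<tau>))"
  by (rule Phi_bar_simps)

text \<open>
  The expansions are sums over trees whose children are ordered and whose vertices carry the index
  of a component of the problem. Ordering the children absorbs all symmetry factors: Taylor's
  formula contributes \<open>1 / fact k\<close> for every list of k children, while unordered trees would need
  the number of their automorphisms. The labels turn vector valued elementary differentials into
  real numbers. A chain of q square vertices together with the fat vertex below it is a single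
  node, since it stands for one factor, the q-th derivative of the matrix; \<open>q = 0\<close> is a
  fat vertex alone.
\<close>

datatype ltree =
    Bullet nat "ltree list"
  | Fat_Leaf nat nat
  | Fat_Stem nat nat ltree

primrec lab :: "ltree \<Rightarrow> nat" where
  "lab (Bullet m ts) = m"
| "lab (Fat_Leaf q m) = m"
| "lab (Fat_Stem q m t) = m"

fun labels_below :: "nat \<Rightarrow> ltree \<Rightarrow> bool" where
  "labels_below N (Bullet m ts) \<longleftrightarrow> m < N \<and> (\<forall>t\<in>set ts. labels_below N t)"
| "labels_below N (Fat_Leaf q m) \<longleftrightarrow> m < N"
| "labels_below N (Fat_Stem q m t) \<longleftrightarrow> m < N \<and> labels_below N t"

primrec erase :: "ltree \<Rightarrow> kind rtree" where
  "erase (Bullet m ts) = Node Meagre (mset (map erase ts))"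
| "erase (Fat_Leaf q m) = theta q {#}"
| "erase (Fat_Stem q m t) = theta q {#erase t#}"

abbreviation vertices :: "ltree \<Rightarrow> nat" where
  "vertices t \<equiv> rho (erase t)"

lemma vertices_simps:
  "vertices (Bullet m ts) = Suc (sum_list (map vertices ts))"
  "vertices (Fat_Leaf q m) = Suc q"
  "vertices (Fat_Stem q m t) = Suc q + vertices t"
  by (simp_all flip: sum_mset_sum_list add: image_mset.compositionality comp_def)

lemma lab_less: "labels_below N t \<Longrightarrow> lab t < N"
  by (cases t) auto

lemma vertices_pos: "0 < vertices t"
  by (cases t) (simp_all add: vertices_simps del: erase.simps)

lemma lw2_subtree_erase: "lw2_subtree (erase t)"
  by (induction t) (auto intro!: lw2_subtree.meagre lw2_subtree_theta)

definition ltrees :: "nat \<Rightarrow> nat \<Rightarrow> nat \<Rightarrow> ltree set" where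
  "ltrees N n m = {t. labels_below N t \<and> lab t = m \<and> vertices t \<le> n}"

text \<open>The lists of children that a meagre root can have in a tree with at most \<open>n + 1\<close> vertices.\<close>

definition forests :: "nat \<Rightarrow> nat \<Rightarrow> ltree list set" where
  "forests N n = {ts. (\<forall>t\<in>set ts. labels_below N t) \<and> sum_list (map vertices ts) \<le> n}"

lemma length_le_vertices: "length ts \<le> sum_list (map vertices ts)"
proof (induction ts)
  case (Cons t ts)
  then show ?case using vertices_pos[of t] by simp
qed simp

lemma vertices_le_sum_list: "t \<in> set ts \<Longrightarrow> vertices t \<le> sum_list (map vertices ts)"
  by (rule member_le_sum_list) auto

text \<open>
  Finiteness needs the bound on the labels, and it uses that every child has at least one vertex,
  which bounds the number of children.
\<close>

lemma finite_labelled: "finite {t. labels_below N t \<and> vertices t \<le> n}"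
proof (induction n)
  case 0
  have "{t. labels_below N t \<and> vertices t \<le> 0} = {}"
    using vertices_pos by auto
  then show ?case by (simp only:) simp
next
  case (Suc n)
  let ?S = "{t. labels_below N t \<and> vertices t \<le> n}"
  have "{t. labels_below N t \<and> vertices t \<le> Suc n} \<subseteq>
      (\<lambda>(m, ts). Bullet m ts) ` ({..<N} \<times> {ts. set ts \<subseteq> ?S \<and> length ts \<le> n}) \<union>
      (\<lambda>(q, m). Fat_Leaf q m) ` ({..n} \<times> {..<N}) \<union>
      (\<lambda>(q, m, t). Fat_Stem q m t) ` ({..n} \<times> {..<N} \<times> ?S)" (is "_ \<subseteq> ?R")
  proof
    fix t assume t: "t \<in> {t. labels_below N t \<and> vertices t \<le> Suc n}"
    show "t \<in> ?R"
    proof (cases t)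
      case (Bullet m ts)
      then have "length ts \<le> n" "set ts \<subseteq> ?S"
        using t length_le_vertices[of ts] vertices_le_sum_list[of _ ts]
        by (force simp: vertices_simps simp del: erase.simps)+
      then show ?thesis
        using t Bullet by (intro UnI1) (auto simp: image_iff)
    next
      case (Fat_Leaf q m)
      then show ?thesis
        using t by (intro UnI1 UnI2) (auto simp: image_iff)
    next
      case (Fat_Stem q m t')
      then show ?thesis
        using t by (intro UnI2) (auto simp: image_iff)
    qed
  qed
  moreover have "finite ?R"
    using Suc by (intro finite_UnI finite_imageI finite_cartesian_product finite_lists_length_le) auto
  ultimately show ?case
    by (rule finite_subset)
qed

lemma finite_ltrees [simp]: "finite (ltrees N n m)"
  by (rule finite_subset[OF _ finite_labelled[of N n]]) (auto simp: ltrees_def)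

lemma finite_forests [simp]: "finite (forests N n)"
proof (rule finite_subset)
  show "forests N n \<subseteq> {ts. set ts \<subseteq> {t. labels_below N t \<and> vertices t \<le> n} \<and> length ts \<le> n}"
  proof
    fix ts assume "ts \<in> forests N n"
    then show "ts \<in> {ts. set ts \<subseteq> {t. labels_below N t \<and> vertices t \<le> n} \<and> length ts \<le> n}"
      using length_le_vertices[of ts] vertices_le_sum_list[of _ ts]
      by (force simp: forests_def)
  qed
qed (intro finite_lists_length_le finite_labelled)

lemma ltrees_0 [simp]: "ltrees N 0 m = {}"
  using vertices_pos by (auto simp: ltrees_def)

lemma ltrees_Suc:
  assumes "m < N"
  shows "ltrees N (Suc n) m = Bullet m ` forests N n \<union> ((\<lambda>q. Fat_Leaf q m) ` {..n} \<union>
    (\<lambda>(q, l, t). Fat_Stem q m t) ` (SIGMA q:{..n}. SIGMA l:{..<N}. ltrees N (n - q) l))"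
    (is "?L = ?R")
proof (rule set_eqI)
  fix t
  show "t \<in> ?L \<longleftrightarrow> t \<in> ?R"
  proof (cases t)
    case (Bullet m' ts)
    then show ?thesis using assms
      by (auto simp: ltrees_def forests_def vertices_simps simp del: erase.simps)
  next
    case (Fat_Leaf q m')
    then show ?thesis using assms
      by (auto simp: ltrees_def vertices_simps simp del: erase.simps)
  next
    case (Fat_Stem q m' t')
    then show ?thesis using assms vertices_pos[of t'] lab_less[of N t']
      by (auto simp: ltrees_def vertices_simps image_iff simp del: erase.simps)
  qed
qed

text \<open>
  Removing the root node splits the trees with at most \<open>n + 1\<close> vertices according to the term of
  the method that they come from: the vector field, the matrix applied to \<open>y0\<close>, and the matrix
  applied to the increment of a stage. This is the induction step of all expansions below.
\<close>

lemma sum_ltrees_Suc: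
  assumes "m < N"
  shows "(\<Sum>t\<in>ltrees N (Suc n) m. f t) = (\<Sum>ts\<in>forests N n. f (Bullet m ts)) +
    (\<Sum>q\<le>n. f (Fat_Leaf q m) + (\<Sum>l<N. \<Sum>t\<in>ltrees N (n - q) l. f (Fat_Stem q m t)))"
proof -
  let ?S = "SIGMA q:{..n}. SIGMA l:{..<N}. ltrees N (n - q) l"
  have fin: "finite ?S" by auto
  have "(\<Sum>t\<in>ltrees N (Suc n) m. f t) = sum f (Bullet m ` forests N n) +
      (sum f ((\<lambda>q. Fat_Leaf q m) ` {..n}) + sum f ((\<lambda>(q, l, t). Fat_Stem q m t) ` ?S))"
    unfolding ltrees_Suc[OF assms]
    by (subst sum.union_disjoint; (subst sum.union_disjoint)?) (auto intro!: finite_imageI)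
  also have "sum f (Bullet m ` forests N n) = (\<Sum>ts\<in>forests N n. f (Bullet m ts))"
    by (subst sum.reindex) (auto simp: inj_on_def)
  also have "sum f ((\<lambda>q. Fat_Leaf q m) ` {..n}) = (\<Sum>q\<le>n. f (Fat_Leaf q m))"
    by (subst sum.reindex) (auto simp: inj_on_def)
  also have "sum f ((\<lambda>(q, l, t). Fat_Stem q m t) ` ?S) = (\<Sum>(q, l, t)\<in>?S. f (Fat_Stem q m t))"
    by (subst sum.reindex) (auto simp: inj_on_def ltrees_def case_prod_unfold)
  also have "\<dots> = (\<Sum>q\<le>n. \<Sum>l<N. \<Sum>t\<in>ltrees N (n - q) l. f (Fat_Stem q m t))"
    by (simp add: sum.Sigma)
  finally show ?thesis
    by (simp add: sum.distrib)
qed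

lemma prod_list_sum:
  fixes f :: "'t \<Rightarrow> real"
  assumes "\<And>l. finite (A l)"
  shows "prod_list (map (\<lambda>l. \<Sum>t\<in>A l. f t) w) =
    (\<Sum>ts\<in>{ts. list_all2 (\<lambda>t l. t \<in> A l) ts w}. prod_list (map f ts))"
proof (induction w)
  case (Cons l w)
  let ?S = "\<lambda>w. {ts. list_all2 (\<lambda>t l. t \<in> A l) ts w}"
  have "?S (l # w) = (\<lambda>(t, ts). t # ts) ` (A l \<times> ?S w)"
    by (auto simp: list_all2_Cons2 image_iff)
  then have "(\<Sum>ts\<in>?S (l # w). prod_list (map f ts)) =
      (\<Sum>(t, ts)\<in>A l \<times> ?S w. f t * prod_list (map f ts))"
    by (simp only:) (subst sum.reindex, auto simp: inj_on_def case_prod_unfold)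
  also have "\<dots> = (\<Sum>t\<in>A l. f t) * (\<Sum>ts\<in>?S w. prod_list (map f ts))"
    by (simp add: sum.cartesian_product [symmetric] sum_product)
  finally show ?case
    using Cons by simp
qed simp

lemma list_all2_ltrees:
  "list_all2 (\<lambda>t l. t \<in> ltrees N n l) ts w \<longleftrightarrow>
     (\<forall>t\<in>set ts. labels_below N t \<and> vertices t \<le> n) \<and> map lab ts = w"
  by (induction ts arbitrary: w) (auto simp: list_all2_Cons1 ltrees_def)


section \<open>Tree expansions in the step size\<close>

locale smooth_problem =
  fixes N :: nat and F :: "(nat \<Rightarrow> real) \<Rightarrow> nat \<Rightarrow> real" and L :: "real \<Rightarrow> nat \<Rightarrow> nat \<Rightarrow> real"
    and t0 :: real and y0 :: "nat \<Rightarrow> real"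
  assumes smooth_F: "smooth_vector_field N F"
    and smooth_L: "smooth_matrix N L"
    and y0: "y0 \<in> euc N"
begin

abbreviation L_deriv :: "nat \<Rightarrow> nat \<Rightarrow> nat \<Rightarrow> real" where
  "L_deriv q m l \<equiv> (deriv ^^ q) (\<lambda>u. L u m l) t0"

text \<open>
  The elementary differentials at \<open>(t0, y0)\<close>, with the factorials from the Taylor expansions of
  the vector field and of the matrix included. They depend on the problem only; the method
  enters through the weights in the sums below.
\<close>

fun ediff :: "ltree \<Rightarrow> real" where
  "ediff (Bullet m ts) =
     iterated_partial (map lab ts) (\<lambda>x. F x m) y0 / fact (length ts) * prod_list (map ediff ts)"
| "ediff (Fat_Leaf q m) = (\<Sum>l<N. L_deriv q m l / fact q * y0 l)"
| "ediff (Fat_Stem q m t) = L_deriv q m (lab t) / fact q * ediff t"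

text \<open>
  A truncated B-series without its constant term \<open>y0\<close>. The exact solution, each stage and the
  update are of this form, for the same elementary differentials and different weights \<open>W\<close>.
\<close>

definition bser :: "(ltree \<Rightarrow> real) \<Rightarrow> nat \<Rightarrow> nat \<Rightarrow> real \<Rightarrow> real" where
  "bser W n m h = (\<Sum>t\<in>ltrees N n m. W t * ediff t * h ^ vertices t)"

lemma bser_0 [simp]: "bser W 0 m h = 0"
  by (simp add: bser_def)

lemma bser_tendsto_0: "(bser W n m \<longlongrightarrow> 0) (at 0)"
proof -
  have "((\<lambda>h. \<Sum>t\<in>ltrees N n m. W t * ediff t * h ^ vertices t) \<longlongrightarrow>
      (\<Sum>t\<in>ltrees N n m. W t * ediff t * 0 ^ vertices t)) (at 0)"
    by (intro tendsto_intros)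
  then show ?thesis
    using vertices_pos[THEN gr_implies_not0] by (simp add: bser_def [abs_def] power_0_left)
qed

lemma bser_truncate: "k \<le> n \<Longrightarrow> jet_eq (Suc k) (bser W n m) (bser W k m)"
  unfolding bser_def by (rule jet_eq_truncate, rule finite_ltrees) (auto simp: ltrees_def)

lemma bser_sum:
  "(\<Sum>j\<in>J. c j * bser (W j) n m h) = bser (\<lambda>t. \<Sum>j\<in>J. c j * W j t) n m h"
  unfolding bser_def by (simp add: sum_distrib_left sum_distrib_right mult_ac sum.swap[of _ J])

lemma bser_Suc:
  assumes "m < N"
  shows "bser W (Suc n) m h =
    (\<Sum>ts\<in>forests N n. W (Bullet m ts) * ediff (Bullet m ts) * h ^ vertices (Bullet m ts)) +
    (\<Sum>q\<le>n. W (Fat_Leaf q m) * ediff (Fat_Leaf q m) * h ^ vertices (Fat_Leaf q m) +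
       (\<Sum>l<N. \<Sum>t\<in>ltrees N (n - q) l.
          W (Fat_Stem q m t) * ediff (Fat_Stem q m t) * h ^ vertices (Fat_Stem q m t)))"
  unfolding bser_def by (rule sum_ltrees_Suc[OF assms])

text \<open>
  Inserting a B-series into the vector field: each term of the Taylor polynomial is a product of
  increments, and multiplying out the sums over trees collects the forests that hang below a new
  meagre root. A forest with more than \<open>n\<close> vertices contributes only to higher powers of \<open>h\<close>.
\<close>

lemma field_jet:
  assumes Y: "\<forall>\<^sub>F h in at 0. Y h \<in> euc N"
    and exp: "\<And>l. l < N \<Longrightarrow> jet_eq (Suc n) (\<lambda>h. Y h l) (\<lambda>h. y0 l + bser W n l h)"
    and m: "m < N"
  shows "jet_eq (Suc n) (\<lambda>h. F (Y h) m)
    (\<lambda>h. \<Sum>ts\<in>forests N n. prod_list (map W ts) * ediff (Bullet m ts) *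
        h ^ sum_list (map vertices ts))"
proof -
  let ?f = "\<lambda>x. F x m"
  let ?g = "\<lambda>h ts. prod_list (map W ts) * ediff (Bullet m ts) * h ^ sum_list (map vertices ts)"
  let ?S = "\<lambda>k. {ts. (\<forall>t\<in>set ts. labels_below N t \<and> vertices t \<le> n) \<and> length ts = k}"
  let ?U = "{ts. (\<forall>t\<in>set ts. labels_below N t \<and> vertices t \<le> n) \<and> length ts \<le> n}"
  let ?b = "\<lambda>h. \<lambda>t. W t * ediff t * h ^ vertices t"
  have sm: "smooth_fun N ?f"
    using smooth_F m by (simp add: smooth_vector_field_def)
  have near: "jet_eq 1 (\<lambda>h. Y h l) (\<lambda>_. y0 l)" if "l < N" for l
  proof -
    have "jet_eq (Suc 0) (\<lambda>h. y0 l + bser W n l h) (\<lambda>h. y0 l + bser W 0 l h)"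
      by (intro jet_eq_add jet_eq_refl bser_truncate) simp
    from jet_eq_trans[OF jet_eq_weaken[OF exp[OF that]] this] show ?thesis
      by simp
  qed
  have finU: "finite ?U" and finS: "finite (?S k)" for k
    using finite_lists_length_le[OF finite_labelled, of N n n]
      finite_lists_length_eq[OF finite_labelled, of N n k]
    by (simp_all add: subset_iff Ball_def)
  have "jet_eq (Suc n) (\<lambda>h. F (Y h) m) (\<lambda>h. \<Sum>k<Suc n. (\<Sum>w\<in>words N k.
      iterated_partial w ?f y0 * prod_list (map (\<lambda>l. Y h l - y0 l) w)) / fact k)"
    by (rule jet_eq_Taylor[OF sm y0 Y near])
  also have "jet_eq (Suc n) (\<lambda>h. \<Sum>k<Suc n. (\<Sum>w\<in>words N k.
        iterated_partial w ?f y0 * prod_list (map (\<lambda>l. Y h l - y0 l) w)) / fact k)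
      (\<lambda>h. \<Sum>k<Suc n. (\<Sum>w\<in>words N k.
        iterated_partial w ?f y0 * prod_list (map (\<lambda>l. bser W n l h) w)) / fact k)"
  proof -
    have "jet_eq (Suc n) (\<lambda>h. prod_list (map (\<lambda>l. Y h l - y0 l) w))
        (\<lambda>h. prod_list (map (\<lambda>l. bser W n l h) w))" if "w \<in> words N k" for w k
    proof (rule jet_eq_prod_list)
      show "jet_eq (Suc n) (\<lambda>h. Y h l - y0 l) (\<lambda>h. bser W n l h)" if "l \<in> set w" for l
        using jet_eq_diff[OF exp[of l], of "\<lambda>_. y0 l" "\<lambda>_. y0 l"] that \<open>w \<in> words N k\<close>
        by (auto simp: words_def)
      show "(\<lambda>h. bser W n l h) \<in> O[at 0](\<lambda>_. 1)" for l
        by (rule bounded_of_tendsto_at_0) (rule bser_tendsto_0)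
    qed
    then show ?thesis
      by (simp only: divide_inverse mult.commute[of _ "inverse _"])
        (intro jet_eq_sum jet_eq_cmult, auto)
  qed
  also have "(\<lambda>h. \<Sum>k<Suc n. (\<Sum>w\<in>words N k.
        iterated_partial w ?f y0 * prod_list (map (\<lambda>l. bser W n l h) w)) / fact k) =
      (\<lambda>h. \<Sum>ts\<in>?U. ?g h ts)"
  proof
    fix h
    have g: "?g h ts = iterated_partial (map lab ts) ?f y0 * prod_list (map (?b h) ts) /
        fact (length ts)" for ts
    proof -
      have "prod_list (map (?b h) ts) =
          prod_list (map W ts) * prod_list (map ediff ts) * h ^ sum_list (map vertices ts)"
        by (induction ts) (simp_all add: power_add mult_ac)
      then show ?thesis by simp
    qed
    have level: "(\<Sum>w\<in>words N k. iterated_partial w ?f y0 *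
        prod_list (map (\<lambda>l. bser W n l h) w)) / fact k = (\<Sum>ts\<in>?S k. ?g h ts)" for k
    proof -
      have "(\<Sum>ts\<in>?S k. ?g h ts) = (\<Sum>w\<in>words N k. \<Sum>ts\<in>{ts \<in> ?S k. map lab ts = w}. ?g h ts)"
        by (rule sum.group [symmetric], rule finS, rule finite_words) (auto simp: words_def lab_less)
      also have "\<dots> = (\<Sum>w\<in>words N k.
          (iterated_partial w ?f y0 * prod_list (map (\<lambda>l. bser W n l h) w)) / fact k)"
      proof (rule sum.cong [OF refl])
        fix w assume w: "w \<in> words N k"
        have "{ts. list_all2 (\<lambda>t l. t \<in> ltrees N n l) ts w} = {ts \<in> ?S k. map lab ts = w}"
          using w by (auto simp: list_all2_ltrees words_def)
        then have "prod_list (map (\<lambda>l. bser W n l h) w) =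
            (\<Sum>ts\<in>{ts \<in> ?S k. map lab ts = w}. prod_list (map (?b h) ts))"
          using prod_list_sum[of "ltrees N n" "?b h" w] by (simp add: bser_def)
        then show "(\<Sum>ts\<in>{ts \<in> ?S k. map lab ts = w}. ?g h ts) =
            (iterated_partial w ?f y0 * prod_list (map (\<lambda>l. bser W n l h) w)) / fact k"
          unfolding g by (simp add: sum_distrib_left sum_divide_distrib)
      qed
      finally show ?thesis
        by (simp add: sum_divide_distrib)
    qed
    have "(\<Sum>ts\<in>?U. ?g h ts) = (\<Sum>k<Suc n. \<Sum>ts\<in>{ts \<in> ?U. length ts = k}. ?g h ts)"
      by (rule sum.group [symmetric]) (use finU in auto)
    also have "\<dots> = (\<Sum>k<Suc n. \<Sum>ts\<in>?S k. ?g h ts)"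
      by (intro sum.cong) auto
    finally show "(\<Sum>k<Suc n. (\<Sum>w\<in>words N k.
        iterated_partial w ?f y0 * prod_list (map (\<lambda>l. bser W n l h) w)) / fact k) =
      (\<Sum>ts\<in>?U. ?g h ts)"
      unfolding level by simp
  qed
  also have "jet_eq (Suc n) (\<lambda>h. \<Sum>ts\<in>?U. ?g h ts) (\<lambda>h. \<Sum>ts\<in>forests N n. ?g h ts)"
  proof (rule jet_eq_truncate[OF finU])
    show "forests N n \<subseteq> ?U"
    proof
      fix ts assume "ts \<in> forests N n"
      then show "ts \<in> ?U"
        using length_le_vertices[of ts] vertices_le_sum_list[of _ ts]
        by (force simp: forests_def)
    qed
  qed (auto simp: forests_def)
  finally show ?thesis .
qed

text \<open>
  The q-th Taylor coefficient of the matrix comes with the factor \<open>h ^ Suc q\<close>, so the series that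
  it is applied to matters only up to \<open>n - q\<close> vertices. The number \<open>\<kappa>\<close> is the weight of
  \<open>y0\<close>; it differs from 1 when the matrix is applied to a linear combination of stages.
\<close>

lemma matrix_jet:
  assumes exp: "\<And>l. l < N \<Longrightarrow> jet_eq (Suc n) (u l) (\<lambda>h. \<kappa> * y0 l + bser W n l h)"
    and q: "q \<le> n"
  shows "jet_eq (Suc (Suc n)) (\<lambda>h. h ^ Suc q * (\<Sum>l<N. L_deriv q m l / fact q * u l h))
    (\<lambda>h. \<kappa> * ediff (Fat_Leaf q m) * h ^ vertices (Fat_Leaf q m) +
      (\<Sum>l<N. \<Sum>t\<in>ltrees N (n - q) l.
         W t * ediff (Fat_Stem q m t) * h ^ vertices (Fat_Stem q m t)))"
proof -
  have "jet_eq (Suc (n - q)) (\<lambda>h. \<Sum>l<N. L_deriv q m l / fact q * u l h)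
      (\<lambda>h. \<Sum>l<N. L_deriv q m l / fact q * (\<kappa> * y0 l + bser W (n - q) l h))"
  proof (intro jet_eq_sum jet_eq_cmult)
    fix l assume "l \<in> {..<N}"
    then have "jet_eq (Suc (n - q)) (u l) (\<lambda>h. \<kappa> * y0 l + bser W n l h)"
      using exp jet_eq_weaken by (metis Suc_le_mono diff_le_self lessThan_iff)
    also have "jet_eq (Suc (n - q)) \<dots> (\<lambda>h. \<kappa> * y0 l + bser W (n - q) l h)"
      by (intro jet_eq_add jet_eq_refl bser_truncate) simp
    finally show "jet_eq (Suc (n - q)) (u l) (\<lambda>h. \<kappa> * y0 l + bser W (n - q) l h)" .
  qed
  from jet_eq_power_mult[OF this, of "Suc q"]
  have "jet_eq (Suc (Suc n)) (\<lambda>h. h ^ Suc q * (\<Sum>l<N. L_deriv q m l / fact q * u l h))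
      (\<lambda>h. h ^ Suc q * (\<Sum>l<N. L_deriv q m l / fact q * (\<kappa> * y0 l + bser W (n - q) l h)))"
    using q by simp
  also have "(\<lambda>h. h ^ Suc q * (\<Sum>l<N. L_deriv q m l / fact q * (\<kappa> * y0 l + bser W (n - q) l h))) =
    (\<lambda>h. \<kappa> * ediff (Fat_Leaf q m) * h ^ vertices (Fat_Leaf q m) +
      (\<Sum>l<N. \<Sum>t\<in>ltrees N (n - q) l.
         W t * ediff (Fat_Stem q m t) * h ^ vertices (Fat_Stem q m t)))"
  proof
    fix h
    have "h ^ Suc q * (L_deriv q m l / fact q * bser W (n - q) l h) =
        (\<Sum>t\<in>ltrees N (n - q) l. W t * ediff (Fat_Stem q m t) * h ^ vertices (Fat_Stem q m t))" for l
      unfolding bser_def sum_distrib_left vertices_simps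
      by (intro sum.cong) (simp_all add: ltrees_def power_add mult_ac del: erase.simps)
    moreover have "\<kappa> * ediff (Fat_Leaf q m) * h ^ vertices (Fat_Leaf q m) =
        (\<Sum>l<N. h ^ Suc q * (L_deriv q m l / fact q * (\<kappa> * y0 l)))"
      unfolding vertices_simps
      by (simp add: sum_distrib_left sum_distrib_right mult_ac del: erase.simps)
    ultimately show "h ^ Suc q * (\<Sum>l<N. L_deriv q m l / fact q * (\<kappa> * y0 l + bser W (n - q) l h)) =
      \<kappa> * ediff (Fat_Leaf q m) * h ^ vertices (Fat_Leaf q m) +
      (\<Sum>l<N. \<Sum>t\<in>ltrees N (n - q) l.
         W t * ediff (Fat_Stem q m t) * h ^ vertices (Fat_Stem q m t))"
      by (simp only: sum_distrib_left distrib_left sum.distrib)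
  qed
  finally show ?thesis .
qed

lemma L_deriv_has_derivative:
  assumes "m < N" "l < N"
  shows "((deriv ^^ k) (\<lambda>u. L u m l) has_real_derivative (deriv ^^ Suc k) (\<lambda>u. L u m l) t) (at t)"
  using smooth_L assms unfolding smooth_matrix_def
  by (simp add: DERIV_deriv_iff_field_differentiable)

lemma matrix_Taylor:
  assumes "m < N" "l < N"
  shows "jet_eq (Suc n) (\<lambda>h. L (t0 + h * e) m l)
    (\<lambda>h. \<Sum>q\<le>n. e ^ q * h ^ q * (L_deriv q m l / fact q))"
proof -
  define D where "D k x = (deriv ^^ k) (\<lambda>u. L u m l) (t0 + x)" for k x
  have D: "(D k has_real_derivative D (Suc k) x) (at x)" for k x
    unfolding D_def using L_deriv_has_derivative[OF assms, of k "t0 + x"]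
    by (subst (asm) add.commute) (simp only: DERIV_shift add.commute[of t0])
  have "\<forall>h. \<exists>\<theta>. \<bar>\<theta>\<bar> \<le> \<bar>h * e\<bar> \<and> D 0 (h * e) =
      (\<Sum>q<Suc n. D q 0 / fact q * (h * e) ^ q) + D (Suc n) \<theta> / fact (Suc n) * (h * e) ^ Suc n"
    using Maclaurin_all_le[of D "D 0"] D by blast
  then obtain \<theta> where \<theta>: "\<And>h. \<bar>\<theta> h\<bar> \<le> \<bar>h * e\<bar>" "\<And>h. D 0 (h * e) =
      (\<Sum>q<Suc n. D q 0 / fact q * (h * e) ^ q) + D (Suc n) (\<theta> h) / fact (Suc n) * (h * e) ^ Suc n"
    unfolding choice_iff by blast
  have "((\<lambda>h. \<bar>h * e\<bar>) \<longlongrightarrow> 0) (at 0)"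
    by (auto intro!: tendsto_eq_intros)
  then have "(\<theta> \<longlongrightarrow> 0) (at 0)"
    by (rule Lim_null_comparison[rotated]) (use \<theta>(1) in auto)
  then have "((\<lambda>h. D (Suc n) (\<theta> h)) \<longlongrightarrow> D (Suc n) 0) (at 0)"
    using DERIV_isCont[OF D] isCont_tendsto_compose by blast
  then have "(\<lambda>h. D (Suc n) (\<theta> h)) \<in> O[at 0](\<lambda>_. 1)"
    by (rule bounded_of_tendsto_at_0)
  then have "(\<lambda>h. D (Suc n) (\<theta> h) * h ^ Suc n) \<in> O[at 0](\<lambda>h. 1 * h ^ Suc n)"
    by (rule landau_o.big.mult) simp
  then have "(\<lambda>h. e ^ Suc n / fact (Suc n) * (D (Suc n) (\<theta> h) * h ^ Suc n)) \<in> O[at 0](\<lambda>h. h ^ Suc n)"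
    by (cases "e = 0") (simp_all del: power_Suc)
  then have "jet_eq (Suc n) (\<lambda>h. D 0 (h * e)) (\<lambda>h. \<Sum>q<Suc n. D q 0 / fact q * (h * e) ^ q)"
    unfolding jet_eq_def \<theta>(2) by (simp add: power_mult_distrib mult_ac)
  then show ?thesis
    by (simp add: D_def power_mult_distrib mult_ac lessThan_Suc_atMost)
qed

end


section \<open>The weights of the exact and of the numerical solution\<close>

definition stage_weight ::
    "nat \<Rightarrow> (nat \<Rightarrow> nat \<Rightarrow> real) \<Rightarrow> (nat \<Rightarrow> nat \<Rightarrow> real) \<Rightarrow> nat \<Rightarrow> ltree \<Rightarrow> real" where
  "stage_weight s a \<gamma> i t = Phi_bar s a \<gamma> i (erase t)"

lemma stage_weight_Bullet:
  "stage_weight s a \<gamma> i (Bullet m ts) =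
     (\<Sum>k=1..s. a i k * prod_list (map (stage_weight s a \<gamma> k) ts))"
  by (simp add: stage_weight_def [abs_def] Phi_bar_Meagre image_mset.compositionality comp_def
      flip: prod_mset_prod_list)

lemma stage_weight_chain:
  "stage_weight s a \<gamma> i (Fat_Leaf 0 m) = (\<Sum>k=1..s. \<gamma> i k)"
  "stage_weight s a \<gamma> i (Fat_Stem 0 m t) = (\<Sum>k=1..s. \<gamma> i k * stage_weight s a \<gamma> k t)"
  "q \<ge> 1 \<Longrightarrow> stage_weight s a \<gamma> i (Fat_Leaf q m) = \<gamma> i i ^ Suc q"
  "q \<ge> 1 \<Longrightarrow> stage_weight s a \<gamma> i (Fat_Stem q m t) = \<gamma> i i ^ Suc q * stage_weight s a \<gamma> i t"
  using Phi_bar_theta[of q s a \<gamma> i] by (simp_all add: stage_weight_def Phi_bar_simps)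

definition update_weight ::
    "nat \<Rightarrow> (nat \<Rightarrow> nat \<Rightarrow> real) \<Rightarrow> (nat \<Rightarrow> nat \<Rightarrow> real) \<Rightarrow> (nat \<Rightarrow> real) \<Rightarrow> (nat \<Rightarrow> real) \<Rightarrow>
     ltree \<Rightarrow> real" where
  "update_weight s a \<gamma> b g t = (\<Sum>j=1..s. Phi s a \<gamma> b g j (erase t))"

lemma update_weight_Bullet:
  "update_weight s a \<gamma> b g (Bullet m ts) =
     (\<Sum>k=1..s. b k * prod_list (map (stage_weight s a \<gamma> k) ts))"
  by (simp add: update_weight_def stage_weight_def [abs_def] Phi_def image_mset.compositionality comp_def
      flip: prod_mset_prod_list)

lemma update_weight_chain:
  "update_weight s a \<gamma> b g (Fat_Leaf 0 m) = (\<Sum>k=1..s. g k)"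
  "update_weight s a \<gamma> b g (Fat_Stem 0 m t) = (\<Sum>k=1..s. g k * stage_weight s a \<gamma> k t)"
  "q \<ge> 1 \<Longrightarrow> update_weight s a \<gamma> b g (Fat_Leaf q m) = 0"
  "q \<ge> 1 \<Longrightarrow> update_weight s a \<gamma> b g (Fat_Stem q m t) = 0"
  by (simp_all add: update_weight_def Phi_def stage_weight_def root_theta)

text \<open>
  The exact solution does not depend on the matrix, which is why every tree with a vertex that is
  not meagre gets weight 0.
\<close>

definition exact_weight :: "ltree \<Rightarrow> real" where
  "exact_weight t =
     (if set_rtree (erase t) \<subseteq> {Meagre} then 1 / real (tree_gamma (erase t)) else 0)"

lemma set_rtree_theta: "\<not> set_rtree (theta q ts) \<subseteq> {Meagre}"
  by (cases q) simp_all

lemma exact_weight_chain [simp]: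
  "exact_weight (Fat_Leaf q m) = 0" "exact_weight (Fat_Stem q m t) = 0"
  by (simp_all add: exact_weight_def set_rtree_theta)

text \<open>
  The factor \<open>vertices\<close> in the denominator is what integrating \<open>h ^ (vertices - 1)\<close> produces.
\<close>

lemma exact_weight_Bullet:
  "exact_weight (Bullet m ts) =
     prod_list (map exact_weight ts) / real (vertices (Bullet m ts))"
proof (cases "\<forall>t\<in>set ts. set_rtree (erase t) \<subseteq> {Meagre}")
  case True
  then have "prod_list (map exact_weight ts) = 1 / real (prod_list (map (\<lambda>t. tree_gamma (erase t)) ts))"
    by (induction ts) (auto simp: exact_weight_def)
  moreover have "set_rtree (erase (Bullet m ts)) \<subseteq> {Meagre}"
    using True by auto
  moreover have "tree_gamma (erase (Bullet m ts)) =
      vertices (Bullet m ts) * prod_list (map (\<lambda>t. tree_gamma (erase t)) ts)"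
    by (simp add: image_mset.compositionality comp_def flip: prod_mset_prod_list)
  ultimately show ?thesis
    by (simp add: exact_weight_def del: erase.simps)
next
  case False
  then obtain t where "t \<in> set ts" "\<not> set_rtree (erase t) \<subseteq> {Meagre}"
    by blast
  then have "t \<in> set ts" "exact_weight t = 0"
    by (simp_all add: exact_weight_def)
  then have "prod_list (map exact_weight ts) = 0"
    by (force simp: prod_list_zero_iff)
  moreover have "\<not> set_rtree (erase (Bullet m ts)) \<subseteq> {Meagre}"
    using False by auto
  ultimately show ?thesis
    by (simp add: exact_weight_def del: erase.simps)
qed


section \<open>Expansion of the exact solution\<close>

context smooth_problem
begin

lemma F_bounded:
  fixes Y :: "real \<Rightarrow> nat \<Rightarrow> real"
  assumes Y: "\<forall>\<^sub>F h in at 0. Y h \<in> euc N"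
    and near: "\<And>l. l < N \<Longrightarrow> ((\<lambda>h. Y h l) \<longlongrightarrow> y0 l) (at 0)" and m: "m < N"
  shows "(\<lambda>h. F (Y h) m) \<in> O[at 0](\<lambda>_. 1)"
proof (rule bounded_of_tendsto_at_0)
  have "smooth_fun N (\<lambda>x. F x m)"
    using smooth_F m by (simp add: smooth_vector_field_def)
  from smooth_fun_tendsto[OF this, of "[]", OF _ y0 Y near]
  show "((\<lambda>h. F (Y h) m) \<longlongrightarrow> F y0 m) (at 0)"
    by (simp add: iterated_partial.simps)
qed

text \<open>
  Picard iteration on expansions: agreement of the solution with its B-series to one order gives
  agreement of the right-hand sides, and integrating gains the next order.
\<close>

lemma exact_jet:
  assumes sol: "local_solution N F t0 y0 y" and m: "m < N"
  shows "jet_eq (Suc n) (\<lambda>h. y (t0 + h) m) (\<lambda>h. y0 m + bser exact_weight n m h)"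
proof -
  from sol obtain \<delta> where \<delta>: "\<delta> > 0" and y_t0: "y t0 = y0"
    and dom: "\<And>h. \<bar>h\<bar> < \<delta> \<Longrightarrow> y (t0 + h) \<in> euc N"
    and der: "\<And>h m. \<bar>h\<bar> < \<delta> \<Longrightarrow> m < N \<Longrightarrow>
      ((\<lambda>h. y (t0 + h) m) has_real_derivative F (y (t0 + h)) m) (at h)"
  proof -
    from sol obtain \<delta> where \<delta>: "\<delta> > 0" "y t0 = y0" and *: "\<And>t. \<bar>t - t0\<bar> < \<delta> \<Longrightarrow>
      y t \<in> euc N \<and> (\<forall>m<N. ((\<lambda>u. y u m) has_real_derivative F (y t) m) (at t))"
      unfolding local_solution_def by (auto simp: dist_real_def euc_def abs_minus_commute)
    show ?thesis
    proof (rule that[OF \<delta>])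
      show "y (t0 + h) \<in> euc N" if "\<bar>h\<bar> < \<delta>" for h
        using *[of "t0 + h"] that by simp
      show "((\<lambda>h. y (t0 + h) m) has_real_derivative F (y (t0 + h)) m) (at h)"
        if "\<bar>h\<bar> < \<delta>" "m < N" for h m
        using *[of "t0 + h"] that DERIV_shift[of "\<lambda>u. y u m" "F (y (t0 + h)) m" h t0]
        by (simp add: add.commute)
    qed
  qed
  have ev: "\<forall>\<^sub>F h in at 0. y (t0 + h) \<in> euc N"
    using dom \<delta> by (auto simp: eventually_at dist_real_def)
  show ?thesis
    using m
  proof (induction n arbitrary: m)
    case 0
    have "((\<lambda>h. y (t0 + h) l) \<longlongrightarrow> y0 l) (at 0)" if "l < N" for l
      using DERIV_isCont[OF der[OF _ that, of 0]] \<delta> y_t0 by (simp add: isCont_def)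
    then have "jet_eq 0 (\<lambda>h. F (y (t0 + h)) m) (\<lambda>_. 0)"
      using F_bounded[OF ev _ 0] by (simp add: jet_eq_def)
    then have "jet_eq (Suc 0) (\<lambda>h. y (t0 + h) m) (\<lambda>_. y0 m)"
      by (rule jet_eq_antiderivative[OF \<delta> der[OF _ 0], rotated 3]) (use y_t0 in auto)
    then show ?case by simp
  next
    case (Suc n)
    let ?W = exact_weight
    have "jet_eq (Suc n) (\<lambda>h. F (y (t0 + h)) m)
        (\<lambda>h. \<Sum>ts\<in>forests N n. prod_list (map ?W ts) * ediff (Bullet m ts) *
          h ^ sum_list (map vertices ts))"
      by (rule field_jet[OF ev Suc.IH Suc.prems])
    then have "jet_eq (Suc (Suc n)) (\<lambda>h. y (t0 + h) m)
      (\<lambda>h. y0 m + (\<Sum>ts\<in>forests N n. ?W (Bullet m ts) * ediff (Bullet m ts) *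
          h ^ vertices (Bullet m ts)))"
    proof (rule jet_eq_antiderivative[OF \<delta> der[OF _ Suc.prems], rotated 3])
      fix h
      have "((\<lambda>h. ?W (Bullet m ts) * ediff (Bullet m ts) * h ^ vertices (Bullet m ts))
          has_real_derivative
          prod_list (map ?W ts) * ediff (Bullet m ts) * h ^ sum_list (map vertices ts)) (at h)" for ts
        unfolding exact_weight_Bullet vertices_simps
        by (rule derivative_eq_intros refl | simp add: field_simps del: ediff.simps)+
      then show "((\<lambda>h. y0 m + (\<Sum>ts\<in>forests N n. ?W (Bullet m ts) * ediff (Bullet m ts) *
          h ^ vertices (Bullet m ts))) has_real_derivative
          (\<Sum>ts\<in>forests N n. prod_list (map ?W ts) * ediff (Bullet m ts) *
          h ^ sum_list (map vertices ts))) (at h)"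
        by (intro DERIV_add[OF DERIV_const, simplified] DERIV_sum)
    qed (simp_all add: y_t0 vertices_simps del: erase.simps)
    then show ?case
      by (simp add: bser_Suc[OF Suc.prems] del: ediff.simps erase.simps)
  qed
qed

end


section \<open>Expansion of the stages and of the update\<close>

lemma sum_strictly_lower:
  fixes c :: "nat \<Rightarrow> real"
  assumes "i \<in> {1..s}" "\<And>j. j \<in> {1..s} \<Longrightarrow> j \<ge> i \<Longrightarrow> c j = 0"
  shows "(\<Sum>j=1..<i. c j * x j) = (\<Sum>j=1..s. c j * x j)"
  by (rule sum.mono_neutral_left) (use assms in auto)

lemma sum_lower:
  fixes c :: "nat \<Rightarrow> real"
  assumes "i \<in> {1..s}" "\<And>j. j \<in> {1..s} \<Longrightarrow> j > i \<Longrightarrow> c j = 0"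
  shows "(\<Sum>j=1..<i. c j * x j) + c i * x i = (\<Sum>j=1..s. c j * x j)"
proof -
  have "(\<Sum>j=1..s. c j * x j) = (\<Sum>j\<in>insert i {1..<i}. c j * x j)"
    using assms by (intro sum.mono_neutral_right) auto
  then show ?thesis by simp
qed

context smooth_problem
begin

lemma L_bounded:
  assumes "m < N" "l < N"
  shows "(\<lambda>h. L (t0 + h * e) m l) \<in> O[at 0](\<lambda>_. 1)"
proof (rule jet_eq_bounded)
  show "jet_eq (Suc 0) (\<lambda>h. L (t0 + h * e) m l) (\<lambda>_. L_deriv 0 m l)"
    using matrix_Taylor[OF assms, of 0 e] by simp
qed simp

text \<open>
  A stage solves a linear system with matrix \<open>I - h A\<close>. For small \<open>h\<close> its solution is bounded by
  twice the 1-norm of the right-hand side, since \<open>h A\<close> has norm at most 1/2.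
\<close>

lemma linear_implicit_bounded:
  assumes A: "\<And>m l. m < N \<Longrightarrow> l < N \<Longrightarrow> A m l \<in> O[at 0](\<lambda>_. 1)"
    and r: "\<And>m. m < N \<Longrightarrow> r m \<in> O[at 0](\<lambda>_. 1)"
    and eq: "\<forall>\<^sub>F h in at 0. \<forall>m<N. X h m = r m h + h * (\<Sum>l<N. A m l h * X h l)"
    and m: "m < N"
  shows "(\<lambda>h. X h m) \<in> O[at (0::real)](\<lambda>_. 1::real)"
proof -
  have "(\<lambda>h. \<Sum>m<N. \<Sum>l<N. \<bar>A m l h\<bar>) \<in> O[at 0](\<lambda>_. 1)"
    using A by (intro big_sum_in_bigo) auto
  then obtain c where c: "c > 0" "\<forall>\<^sub>F h in at 0. \<bar>\<Sum>m<N. \<Sum>l<N. \<bar>A m l h\<bar>\<bar> \<le> c"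
    by (auto elim!: landau_o.bigE)
  have small: "\<forall>\<^sub>F h in at (0::real). \<bar>h\<bar> * c \<le> 1 / 2"
    using c(1) by (auto simp: eventually_at field_simps intro!: exI[of _ "1 / (2 * c)"])
  have rO: "(\<lambda>h. \<Sum>m<N. \<bar>r m h\<bar>) \<in> O[at 0](\<lambda>_. 1)"
    using r by (intro big_sum_in_bigo) auto
  have "\<forall>\<^sub>F h in at 0. norm (X h m) \<le> 2 * norm (\<Sum>m<N. \<bar>r m h\<bar>)"
    using c(2) small eq
  proof eventually_elim
    case (elim h)
    let ?S = "\<Sum>l<N. \<bar>X h l\<bar>"
    have X_le: "\<bar>X h l\<bar> \<le> ?S" if "l < N" for l
      by (rule member_le_sum) (use that in auto)
    have "\<bar>X h m\<bar> \<le> \<bar>r m h\<bar> + \<bar>h\<bar> * ((\<Sum>l<N. \<bar>A m l h\<bar>) * ?S)" if "m < N" for m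
    proof -
      have "\<bar>\<Sum>l<N. A m l h * X h l\<bar> \<le> (\<Sum>l<N. \<bar>A m l h\<bar> * ?S)"
        by (rule order_trans[OF sum_abs]) (auto intro!: sum_mono mult_left_mono X_le simp: abs_mult)
      then have "\<bar>h * (\<Sum>l<N. A m l h * X h l)\<bar> \<le> \<bar>h\<bar> * ((\<Sum>l<N. \<bar>A m l h\<bar>) * ?S)"
        by (simp add: abs_mult sum_distrib_right mult_left_mono)
      moreover have eq: "X h m = r m h + h * (\<Sum>l<N. A m l h * X h l)"
        using elim(3) that by blast
      have "\<bar>X h m\<bar> \<le> \<bar>r m h\<bar> + \<bar>h * (\<Sum>l<N. A m l h * X h l)\<bar>"
        by (subst eq) (rule abs_triangle_ineq)
      ultimately show ?thesis
        by linarith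
    qed
    then have "?S \<le> (\<Sum>m<N. \<bar>r m h\<bar> + \<bar>h\<bar> * ((\<Sum>l<N. \<bar>A m l h\<bar>) * ?S))"
      by (intro sum_mono) auto
    also have "\<dots> = (\<Sum>m<N. \<bar>r m h\<bar>) + \<bar>h\<bar> * (\<Sum>m<N. \<Sum>l<N. \<bar>A m l h\<bar>) * ?S"
      by (simp add: sum.distrib sum_distrib_left sum_distrib_right mult_ac)
    also have "\<bar>h\<bar> * (\<Sum>m<N. \<Sum>l<N. \<bar>A m l h\<bar>) * ?S \<le> \<bar>h\<bar> * c * ?S"
      using elim(1) by (intro mult_right_mono mult_left_mono) (auto simp: sum_nonneg)
    also have "\<bar>h\<bar> * c * ?S \<le> 1 / 2 * ?S"
      using elim(2) by (intro mult_right_mono) (auto simp: sum_nonneg)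
    \<comment> \<open>Half of \<open>?S\<close> is absorbed into the left-hand side.\<close>
    finally have "?S \<le> 2 * (\<Sum>m<N. \<bar>r m h\<bar>)"
      by simp
    then show ?case
      using X_le[OF m] by (simp add: sum_nonneg)
  qed
  then show ?thesis
    by (rule landau_o.big_trans[OF bigoI rO])
qed

end

locale lirkw2_step = smooth_problem +
  fixes s :: nat and a \<gamma> :: "nat \<Rightarrow> nat \<Rightarrow> real" and b g :: "nat \<Rightarrow> real"
    and Y :: "real \<Rightarrow> nat \<Rightarrow> nat \<Rightarrow> real"
  assumes a_lower: "\<And>i j. i \<in> {1..s} \<Longrightarrow> j \<in> {1..s} \<Longrightarrow> j \<ge> i \<Longrightarrow> a i j = 0"
    and \<gamma>_lower: "\<And>i j. i \<in> {1..s} \<Longrightarrow> j \<in> {1..s} \<Longrightarrow> j > i \<Longrightarrow> \<gamma> i j = 0"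
    and stages: "\<forall>\<^sub>F h in at 0. lirkw2_stages s a \<gamma> N F L t0 y0 h (Y h)"
begin

lemma stages_euc: "i \<in> {1..s} \<Longrightarrow> \<forall>\<^sub>F h in at 0. Y h i \<in> euc N"
  using stages by (rule eventually_mono) (unfold lirkw2_stages_def euc_def, blast)

lemma stage_equation:
  assumes "i \<in> {1..s}"
  shows "\<forall>\<^sub>F h in at 0. \<forall>m<N. Y h i m = y0 m + h * (\<Sum>j=1..<i. a i j * F (Y h j) m)
     + h * (\<Sum>l<N. L t0 m l * (\<Sum>j=1..<i. \<gamma> i j * Y h j l))
     + h * \<gamma> i i * (\<Sum>l<N. L (t0 + h * \<gamma> i i) m l * Y h i l)"
  using stages by (rule eventually_mono) (use assms in \<open>unfold lirkw2_stages_def mat_vec_def, blast\<close>)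

text \<open>
  The start of the induction on the order is itself an induction on the stage number, because the
  right-hand side of a stage is known to be bounded only once the earlier stages are close to \<open>y0\<close>.
\<close>

lemma stage_jet_0:
  assumes "i \<in> {1..s}" "m < N"
  shows "jet_eq 1 (\<lambda>h. Y h i m) (\<lambda>_. y0 m)"
  using assms
proof (induction i arbitrary: m rule: less_induct)
  case (less i)
  have "(\<lambda>h. h * (\<Sum>j=1..<i. a i j * F (Y h j) m)) \<in> O[at 0](\<lambda>h. h * 1)" if "m < N" for m
  proof (intro landau_o.big.mult_left big_sum_in_bigo bigo_cmult)
    fix j assume j: "j \<in> {1..<i}"
    then have js: "j \<in> {1..s}"
      using less.prems(1) by auto
    show "(\<lambda>h. F (Y h j) m) \<in> O[at 0](\<lambda>_. 1)"
    proof (rule F_bounded[OF stages_euc[OF js] _ that])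
      fix l assume "l < N"
      then have "jet_eq (Suc 0) (\<lambda>h. Y h j l) (\<lambda>_. y0 l)"
        using less.IH[of j l] j js by simp
      then show "((\<lambda>h. Y h j l) \<longlongrightarrow> y0 l) (at 0)"
        by (rule jet_eq_tendsto) simp
    qed
  qed
  moreover have YO: "(\<lambda>h. Y h j l) \<in> O[at 0](\<lambda>_. 1)" if "j < i" "j \<ge> 1" "l < N" for j l
    by (rule jet_eq_bounded[OF less.IH]) (use less.prems that in auto)
  then have "(\<lambda>h. h * (\<Sum>l<N. L t0 m l * (\<Sum>j=1..<i. \<gamma> i j * Y h j l))) \<in> O[at 0](\<lambda>h. h * 1)" for m
    by (intro landau_o.big.mult_left big_sum_in_bigo bigo_cmult) auto
  ultimately have r: "(\<lambda>h. h * (\<Sum>j=1..<i. a i j * F (Y h j) m)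
     + h * (\<Sum>l<N. L t0 m l * (\<Sum>j=1..<i. \<gamma> i j * Y h j l))) \<in> O[at 0](\<lambda>h. h)"
    (is "?r m \<in> _") if "m < N" for m
    using that by (intro sum_in_bigo(1)) simp_all
  have hO: "(\<lambda>h. h) \<in> O[at (0::real)](\<lambda>_. 1)"
    using power_bigo_power_at_0[of 0 1] by simp
  have Xi: "(\<lambda>h. Y h i m) \<in> O[at 0](\<lambda>_. 1)" if "m < N" for m
  proof (rule linear_implicit_bounded[where X = "\<lambda>h. Y h i" and r = "\<lambda>m h. y0 m + ?r m h"
        and A = "\<lambda>m l h. \<gamma> i i * L (t0 + h * \<gamma> i i) m l", OF _ _ _ that])
    show "(\<lambda>h. \<gamma> i i * L (t0 + h * \<gamma> i i) m l) \<in> O[at 0](\<lambda>_. 1)" if "m < N" "l < N" for m l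
      by (intro bigo_cmult L_bounded that)
    show "(\<lambda>h. y0 m + ?r m h) \<in> O[at 0](\<lambda>_. 1)" if "m < N" for m
      by (intro sum_in_bigo(1) landau_o.big_trans[OF r[OF that] hO]) simp
    show "\<forall>\<^sub>F h in at 0. \<forall>m<N. Y h i m =
        y0 m + ?r m h + h * (\<Sum>l<N. \<gamma> i i * L (t0 + h * \<gamma> i i) m l * Y h i l)"
      using stage_equation[OF less.prems(1)]
    proof (rule eventually_mono, intro allI impI)
      fix h m
      assume *: "\<forall>m<N. Y h i m = y0 m + h * (\<Sum>j=1..<i. a i j * F (Y h j) m)
          + h * (\<Sum>l<N. L t0 m l * (\<Sum>j=1..<i. \<gamma> i j * Y h j l))
          + h * \<gamma> i i * (\<Sum>l<N. L (t0 + h * \<gamma> i i) m l * Y h i l)" and "m < N"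
      show "Y h i m =
          y0 m + ?r m h + h * (\<Sum>l<N. \<gamma> i i * L (t0 + h * \<gamma> i i) m l * Y h i l)"
        by (subst *[rule_format, OF \<open>m < N\<close>]) (simp add: sum_distrib_left mult_ac)
    qed
  qed
  have implicit: "(\<lambda>h. h * (\<Sum>l<N. \<gamma> i i * L (t0 + h * \<gamma> i i) m l * Y h i l)) \<in> O[at 0](\<lambda>h. h * 1)"
  proof (intro landau_o.big.mult_left big_sum_in_bigo)
    fix l assume "l \<in> {..<N}"
    then have "(\<lambda>h. (\<gamma> i i * L (t0 + h * \<gamma> i i) m l) * Y h i l) \<in> O[at 0](\<lambda>_. 1 * 1)"
      using less.prems by (intro landau_o.big.mult bigo_cmult L_bounded Xi) auto
    then show "(\<lambda>h. \<gamma> i i * L (t0 + h * \<gamma> i i) m l * Y h i l) \<in> O[at 0](\<lambda>_. 1)"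
      by simp
  qed
  have "(\<lambda>h. ?r m h +
      h * (\<Sum>l<N. \<gamma> i i * L (t0 + h * \<gamma> i i) m l * Y h i l)) \<in> O[at 0](\<lambda>h. h)"
    by (rule sum_in_bigo(1)[OF r[OF less.prems(2)]]) (use implicit in simp)
  also have "?this \<longleftrightarrow> (\<lambda>h. Y h i m - y0 m) \<in> O[at 0](\<lambda>h. h)"
  proof (rule landau_o.big.in_cong)
    show "\<forall>\<^sub>F h in at 0. ?r m h + h * (\<Sum>l<N. \<gamma> i i * L (t0 + h * \<gamma> i i) m l * Y h i l) =
        Y h i m - y0 m"
      using stage_equation[OF less.prems(1)]
    proof (rule eventually_mono)
      fix h
      assume *: "\<forall>m<N. Y h i m = y0 m + h * (\<Sum>j=1..<i. a i j * F (Y h j) m)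
          + h * (\<Sum>l<N. L t0 m l * (\<Sum>j=1..<i. \<gamma> i j * Y h j l))
          + h * \<gamma> i i * (\<Sum>l<N. L (t0 + h * \<gamma> i i) m l * Y h i l)"
      show "?r m h + h * (\<Sum>l<N. \<gamma> i i * L (t0 + h * \<gamma> i i) m l * Y h i l) =
          Y h i m - y0 m"
        by (subst *[rule_format, OF less.prems(2)]) (simp add: sum_distrib_left mult_ac)
    qed
  qed
  finally show ?case
    by (simp add: jet_eq_def)
qed

text \<open>
  Every occurrence of a stage on the right-hand side of the stage equations has a factor \<open>h\<close>, also
  in the implicit term. So expansions of all stages to one order give the expansion to the next.
  The implicit term is split by \<open>L\<^sub>i = L + (L\<^sub>i - L)\<close>: the first part completes the sum over the
  earlier stages, which gives the fat vertices, and the Taylor expansion of the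
  second one gives the chains with at least one square.
\<close>

lemma stage_jet:
  assumes "i \<in> {1..s}" "m < N"
  shows "jet_eq (Suc n) (\<lambda>h. Y h i m) (\<lambda>h. y0 m + bser (stage_weight s a \<gamma> i) n m h)"
  using assms
proof (induction n arbitrary: i m)
  case 0
  then show ?case
    using stage_jet_0 by simp
next
  case (Suc n)
  note i = Suc.prems(1) and m = Suc.prems(2)
  let ?w = "stage_weight s a \<gamma>" and ?Li = "\<lambda>h. L (t0 + h * \<gamma> i i)"
  \<comment> \<open>The contributions of the trees with a meagre root and of those with a chain of \<open>q\<close> squares.\<close>
  define B where "B h ts = ?w i (Bullet m ts) * ediff (Bullet m ts) * h ^ vertices (Bullet m ts)" for h ts
  define C where "C q h =
      ?w i (Fat_Leaf q m) * ediff (Fat_Leaf q m) * h ^ vertices (Fat_Leaf q m) +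
      (\<Sum>l<N. \<Sum>t\<in>ltrees N (n - q) l.
          ?w i (Fat_Stem q m t) * ediff (Fat_Stem q m t) * h ^ vertices (Fat_Stem q m t))" for q h
  have exp: "jet_eq (Suc n) (\<lambda>h. Y h j l) (\<lambda>h. 1 * y0 l + bser (?w j) n l h)"
    if "j \<in> {1..s}" "l < N" for j l
    using Suc.IH[OF that] by simp
  have F: "jet_eq (Suc (Suc n)) (\<lambda>h. h * (\<Sum>j=1..s. a i j * F (Y h j) m))
      (\<lambda>h. \<Sum>ts\<in>forests N n. B h ts)"
  proof -
    have "jet_eq (Suc n) (\<lambda>h. \<Sum>j=1..s. a i j * F (Y h j) m) (\<lambda>h. \<Sum>j=1..s. a i j *
        (\<Sum>ts\<in>forests N n. prod_list (map (?w j) ts) * ediff (Bullet m ts) *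
          h ^ sum_list (map vertices ts)))"
      by (intro jet_eq_sum jet_eq_cmult field_jet stages_euc Suc.IH m)
    from jet_eq_power_mult[OF this, of 1] show ?thesis
      by (simp add: B_def stage_weight_Bullet vertices_simps sum_distrib_left sum_distrib_right
          mult_ac sum.swap[of _ "{Suc 0..s}"] del: erase.simps ediff.simps)
  qed
  have L0: "jet_eq (Suc (Suc n))
      (\<lambda>h. h ^ Suc 0 * (\<Sum>l<N. L_deriv 0 m l / fact 0 * (\<Sum>j=1..s. \<gamma> i j * Y h j l))) (C 0)"
    unfolding C_def [abs_def] stage_weight_chain(1,2)
  proof (rule matrix_jet)
    fix l assume l: "l < N"
    have "jet_eq (Suc n) (\<lambda>h. \<Sum>j=1..s. \<gamma> i j * Y h j l)
        (\<lambda>h. \<Sum>j=1..s. \<gamma> i j * (1 * y0 l + bser (?w j) n l h))"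
      by (intro jet_eq_sum jet_eq_cmult exp l)
    also have "\<dots> = (\<lambda>h. (\<Sum>j=1..s. \<gamma> i j) * y0 l +
        bser (\<lambda>t. \<Sum>j=1..s. \<gamma> i j * ?w j t) n l h)"
      by (simp add: distrib_left sum.distrib bser_sum sum_distrib_right)
    finally show "jet_eq (Suc n) (\<lambda>h. \<Sum>j=1..s. \<gamma> i j * Y h j l)
        (\<lambda>h. (\<Sum>j=1..s. \<gamma> i j) * y0 l + bser (\<lambda>t. \<Sum>j=1..s. \<gamma> i j * ?w j t) n l h)" .
  qed simp
  have Lq: "jet_eq (Suc (Suc n))
      (\<lambda>h. \<gamma> i i ^ Suc q * (h ^ Suc q * (\<Sum>l<N. L_deriv q m l / fact q * Y h i l))) (C q)"
    if q: "q \<in> {1..n}" for q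
    using jet_eq_cmult[OF matrix_jet[where u = "\<lambda>l h. Y h i l", OF exp[OF i], of q m],
        of "\<gamma> i i ^ Suc q"] q
    by (simp add: C_def [abs_def] stage_weight_chain(3,4) distrib_left sum_distrib_left mult_ac
        del: erase.simps ediff.simps power_Suc)
  have L: "jet_eq (Suc (Suc n))
      (\<lambda>h. h * \<gamma> i i * (\<Sum>l<N. (?Li h m l - L t0 m l) * Y h i l)) (\<lambda>h. \<Sum>q=1..n. C q h)"
  proof -
    have "jet_eq (Suc n) (\<lambda>h. \<Sum>l<N. (?Li h m l - L t0 m l) * Y h i l)
        (\<lambda>h. \<Sum>l<N. (\<Sum>q=1..n. \<gamma> i i ^ q * h ^ q * (L_deriv q m l / fact q)) * Y h i l)"
    proof (intro jet_eq_sum jet_eq_mult jet_eq_refl)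
      fix l assume "l \<in> {..<N}"
      then have l: "l < N" by simp
      have "jet_eq (Suc n) (\<lambda>h. ?Li h m l - L t0 m l)
          (\<lambda>h. (\<Sum>q\<le>n. \<gamma> i i ^ q * h ^ q * (L_deriv q m l / fact q)) - L t0 m l)"
        by (intro jet_eq_diff matrix_Taylor m l jet_eq_refl)
      also have "(\<lambda>h. (\<Sum>q\<le>n. \<gamma> i i ^ q * h ^ q * (L_deriv q m l / fact q)) - L t0 m l) =
          (\<lambda>h. \<Sum>q=1..n. \<gamma> i i ^ q * h ^ q * (L_deriv q m l / fact q))"
        by (simp add: atMost_atLeast0 sum.atLeast_Suc_atMost)
      finally show "jet_eq (Suc n) (\<lambda>h. ?Li h m l - L t0 m l)
          (\<lambda>h. \<Sum>q=1..n. \<gamma> i i ^ q * h ^ q * (L_deriv q m l / fact q))" .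
      show "(\<lambda>h. \<Sum>q=1..n. \<gamma> i i ^ q * h ^ q * (L_deriv q m l / fact q)) \<in> O[at 0](\<lambda>_. 1)"
        by (rule bounded_of_tendsto_at_0) (rule tendsto_intros)+
      show "(\<lambda>h. Y h i l) \<in> O[at 0](\<lambda>_. 1)"
        by (rule jet_eq_bounded[OF stage_jet_0[OF i l]]) simp
    qed
    from jet_eq_cmult[OF jet_eq_power_mult[OF this, of 1], of "\<gamma> i i"]
    have "jet_eq (Suc (Suc n)) (\<lambda>h. h * \<gamma> i i * (\<Sum>l<N. (?Li h m l - L t0 m l) * Y h i l))
        (\<lambda>h. \<gamma> i i * (h * (\<Sum>l<N. (\<Sum>q=1..n. \<gamma> i i ^ q * h ^ q * (L_deriv q m l / fact q)) * Y h i l)))"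
      by (simp add: mult_ac)
    also have "(\<lambda>h. \<gamma> i i * (h * (\<Sum>l<N. (\<Sum>q=1..n. \<gamma> i i ^ q * h ^ q * (L_deriv q m l / fact q)) * Y h i l))) =
        (\<lambda>h. \<Sum>q=1..n. \<gamma> i i ^ Suc q * (h ^ Suc q * (\<Sum>l<N. L_deriv q m l / fact q * Y h i l)))"
      by (simp add: sum_distrib_left sum_distrib_right mult_ac sum.swap[of _ "{..<N}"])
    also have "jet_eq (Suc (Suc n)) \<dots> (\<lambda>h. \<Sum>q=1..n. C q h)"
      by (intro jet_eq_sum Lq)
    finally show ?thesis .
  qed
  have "jet_eq (Suc (Suc n)) (\<lambda>h. y0 m + h * (\<Sum>j=1..s. a i j * F (Y h j) m) +
      h ^ Suc 0 * (\<Sum>l<N. L_deriv 0 m l / fact 0 * (\<Sum>j=1..s. \<gamma> i j * Y h j l)) +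
      h * \<gamma> i i * (\<Sum>l<N. (?Li h m l - L t0 m l) * Y h i l))
    (\<lambda>h. y0 m + (\<Sum>ts\<in>forests N n. B h ts) + C 0 h + (\<Sum>q=1..n. C q h))"
    by (intro jet_eq_add jet_eq_refl F L0 L)
  also have "(\<lambda>h. y0 m + (\<Sum>ts\<in>forests N n. B h ts) + C 0 h + (\<Sum>q=1..n. C q h)) =
      (\<lambda>h. y0 m + bser (?w i) (Suc n) m h)"
    unfolding bser_Suc[OF m] B_def C_def [symmetric]
    by (simp add: atMost_atLeast0 sum.atLeast_Suc_atMost add.assoc del: erase.simps ediff.simps)
  finally show ?case
  proof (rule jet_eq_cong)
    show "\<forall>\<^sub>F h in at 0. y0 m + h * (\<Sum>j=1..s. a i j * F (Y h j) m) +
        h ^ Suc 0 * (\<Sum>l<N. L_deriv 0 m l / fact 0 * (\<Sum>j=1..s. \<gamma> i j * Y h j l)) +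
        h * \<gamma> i i * (\<Sum>l<N. (?Li h m l - L t0 m l) * Y h i l) = Y h i m"
      using stage_equation[OF i]
    proof (rule eventually_mono)
      fix h
      assume *: "\<forall>m<N. Y h i m = y0 m + h * (\<Sum>j=1..<i. a i j * F (Y h j) m)
          + h * (\<Sum>l<N. L t0 m l * (\<Sum>j=1..<i. \<gamma> i j * Y h j l))
          + h * \<gamma> i i * (\<Sum>l<N. L (t0 + h * \<gamma> i i) m l * Y h i l)"
      have row: "(\<Sum>j=1..<i. \<gamma> i j * x j) + \<gamma> i i * x i = (\<Sum>j=1..s. \<gamma> i j * x j)" for x
        by (rule sum_lower[OF i]) (use \<gamma>_lower[OF i] in auto)
      have "(\<Sum>l<N. L t0 m l * (\<Sum>j=1..s. \<gamma> i j * Y h j l)) =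
          (\<Sum>l<N. L t0 m l * (\<Sum>j=1..<i. \<gamma> i j * Y h j l)) + \<gamma> i i * (\<Sum>l<N. L t0 m l * Y h i l)"
        unfolding row [symmetric]
        by (simp add: distrib_left sum.distrib sum_distrib_left mult_ac)
      then show "y0 m + h * (\<Sum>j=1..s. a i j * F (Y h j) m) +
        h ^ Suc 0 * (\<Sum>l<N. L_deriv 0 m l / fact 0 * (\<Sum>j=1..s. \<gamma> i j * Y h j l)) +
        h * \<gamma> i i * (\<Sum>l<N. (?Li h m l - L t0 m l) * Y h i l) = Y h i m"
        by (subst *[rule_format, OF m])
          (simp add: sum_strictly_lower[where c = "a i", OF i a_lower[OF i], simplified] left_diff_distrib sum_subtractf algebra_simps)
    qed
  qed simp
qed

text \<open>
  The update uses the matrix at \<open>t0\<close> only, so no tree with a square vertex at its root occurs.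
\<close>

lemma update_jet:
  assumes m: "m < N"
  shows "jet_eq (Suc (Suc n)) (\<lambda>h. lirkw2_update s b g N F L t0 y0 h (Y h) m)
    (\<lambda>h. y0 m + bser (update_weight s a \<gamma> b g) (Suc n) m h)"
proof -
  let ?w = "stage_weight s a \<gamma>" and ?v = "update_weight s a \<gamma> b g"
  define B where "B h ts = ?v (Bullet m ts) * ediff (Bullet m ts) * h ^ vertices (Bullet m ts)" for h ts
  define C where "C q h =
      ?v (Fat_Leaf q m) * ediff (Fat_Leaf q m) * h ^ vertices (Fat_Leaf q m) +
      (\<Sum>l<N. \<Sum>t\<in>ltrees N (n - q) l.
          ?v (Fat_Stem q m t) * ediff (Fat_Stem q m t) * h ^ vertices (Fat_Stem q m t))" for q h
  have F: "jet_eq (Suc (Suc n)) (\<lambda>h. h * (\<Sum>j=1..s. b j * F (Y h j) m))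
      (\<lambda>h. \<Sum>ts\<in>forests N n. B h ts)"
  proof -
    have "jet_eq (Suc n) (\<lambda>h. \<Sum>j=1..s. b j * F (Y h j) m) (\<lambda>h. \<Sum>j=1..s. b j *
        (\<Sum>ts\<in>forests N n. prod_list (map (?w j) ts) * ediff (Bullet m ts) *
          h ^ sum_list (map vertices ts)))"
      by (intro jet_eq_sum jet_eq_cmult field_jet stages_euc stage_jet m)
    from jet_eq_power_mult[OF this, of 1] show ?thesis
      by (simp add: B_def update_weight_Bullet vertices_simps sum_distrib_left sum_distrib_right
          mult_ac sum.swap[of _ "{Suc 0..s}"] del: erase.simps ediff.simps)
  qed
  have L0: "jet_eq (Suc (Suc n))
      (\<lambda>h. h ^ Suc 0 * (\<Sum>l<N. L_deriv 0 m l / fact 0 * (\<Sum>j=1..s. g j * Y h j l))) (C 0)"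
    unfolding C_def [abs_def] update_weight_chain(1,2)
  proof (rule matrix_jet)
    fix l assume l: "l < N"
    have "jet_eq (Suc n) (\<lambda>h. \<Sum>j=1..s. g j * Y h j l)
        (\<lambda>h. \<Sum>j=1..s. g j * (y0 l + bser (?w j) n l h))"
      by (intro jet_eq_sum jet_eq_cmult stage_jet l)
    also have "\<dots> = (\<lambda>h. (\<Sum>j=1..s. g j) * y0 l + bser (\<lambda>t. \<Sum>j=1..s. g j * ?w j t) n l h)"
      by (simp add: distrib_left sum.distrib bser_sum sum_distrib_right)
    finally show "jet_eq (Suc n) (\<lambda>h. \<Sum>j=1..s. g j * Y h j l)
        (\<lambda>h. (\<Sum>j=1..s. g j) * y0 l + bser (\<lambda>t. \<Sum>j=1..s. g j * ?w j t) n l h)" .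
  qed simp
  have "C q h = 0" if "q \<ge> 1" for q h
    using that by (simp add: C_def update_weight_chain del: erase.simps ediff.simps)
  then have "(\<lambda>h. y0 m + bser ?v (Suc n) m h) = (\<lambda>h. y0 m + (\<Sum>ts\<in>forests N n. B h ts) + C 0 h)"
    unfolding bser_Suc[OF m] B_def C_def [symmetric]
    by (simp add: atMost_atLeast0 sum.atLeast_Suc_atMost add.assoc del: erase.simps ediff.simps)
  moreover have "jet_eq (Suc (Suc n)) (\<lambda>h. y0 m + h * (\<Sum>j=1..s. b j * F (Y h j) m) +
      h ^ Suc 0 * (\<Sum>l<N. L_deriv 0 m l / fact 0 * (\<Sum>j=1..s. g j * Y h j l)))
    (\<lambda>h. y0 m + (\<Sum>ts\<in>forests N n. B h ts) + C 0 h)"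
    by (intro jet_eq_add jet_eq_refl F L0)
  ultimately show ?thesis
    by (simp add: lirkw2_update_def mat_vec_def)
qed

end

text \<open>
  Exact and numerical solution are B-series with the same elementary differentials, so equal
  weights for all trees with at most p vertices give order p.
\<close>

lemma order_conditions_sufficient:
  assumes "p \<ge> 1"
    and a: "\<And>i j. i \<in> {1..s} \<Longrightarrow> j \<in> {1..s} \<Longrightarrow> j \<ge> i \<Longrightarrow> a i j = 0"
    and \<gamma>: "\<And>i j. i \<in> {1..s} \<Longrightarrow> j \<in> {1..s} \<Longrightarrow> j > i \<Longrightarrow> \<gamma> i j = 0"
    and meagre: "\<And>\<tau>. \<tau> \<in> meagre_trees \<Longrightarrow> rho \<tau> \<le> p \<Longrightarrow>
      (\<Sum>j=1..s. Phi s a \<gamma> b g j \<tau>) = 1 / real (tree_gamma \<tau>)"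
    and other: "\<And>\<tau>. \<tau> \<in> LW2 - meagre_trees \<Longrightarrow> rho \<tau> \<le> p \<Longrightarrow>
      (\<Sum>j=1..s. Phi s a \<gamma> b g j \<tau>) = 0"
  shows "lirkw2_has_order s a \<gamma> b g p"
  unfolding lirkw2_has_order_def
proof (intro allI impI)
  fix N F L t0 y0 y Y and m :: nat
  assume "smooth_vector_field N F" "smooth_matrix N L" "y0 \<in> topspace (Euclidean_space N)"
    and sol: "local_solution N F t0 y0 y"
    and "\<forall>\<^sub>F h in at 0. lirkw2_stages s a \<gamma> N F L t0 y0 h (Y h)" and m: "m < N"
  then interpret lirkw2_step N F L t0 y0 s a \<gamma> b g Y
    by unfold_locales (auto simp: euc_def a \<gamma>)
  have weights: "update_weight s a \<gamma> b g t = exact_weight t" if "vertices t \<le> p" for t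
  proof (cases "root (erase t) = Square")
    case True
    \<comment> \<open>There is no condition for such a tree, but both of its weights vanish.\<close>
    then have "Square \<in> set_rtree (erase t)"
      by (metis rtree.set_sel(1))
    then have "exact_weight t = 0"
      by (auto simp: exact_weight_def)
    moreover have "update_weight s a \<gamma> b g t = 0"
      using True by (simp add: update_weight_def Phi_def)
    ultimately show ?thesis by simp
  next
    case False
    then have "erase t \<in> LW2"
      using lw2_subtree_erase by (simp add: LW2_def)
    then show ?thesis
      using meagre[of "erase t"] other[of "erase t"] that
      by (auto simp: update_weight_def exact_weight_def meagre_trees_def)
  qed
  obtain n where p: "p = Suc n"
    using assms(1) by (cases p) auto
  have "bser (update_weight s a \<gamma> b g) p m h = bser exact_weight p m h" for h
    unfolding bser_def by (rule sum.cong) (auto simp: ltrees_def weights)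
  then have "jet_eq (Suc p) (\<lambda>h. lirkw2_update s b g N F L t0 y0 h (Y h) m) (\<lambda>h. y (t0 + h) m)"
    using update_jet[OF m, of n] jet_eq_sym[OF exact_jet[OF sol m, of p]]
    by (auto simp: p intro: jet_eq_trans)
  then show "(\<lambda>h. lirkw2_update s b g N F L t0 y0 h (Y h) m - y (t0 + h) m)
      \<in> O[at 0](\<lambda>h. h ^ (p + 1))"
    by (simp add: jet_eq_def)
qed


section \<open>Polynomial test problems\<close>

text \<open>
  Polynomials are described by how they are built, which makes them closed under partial
  differentiation and therefore smooth.
\<close>

inductive polynomial_map :: "nat \<Rightarrow> ((nat \<Rightarrow> real) \<Rightarrow> real) \<Rightarrow> bool" for N where
  const: "polynomial_map N (\<lambda>_. c)"
| coordinate: "i < N \<Longrightarrow> polynomial_map N (\<lambda>x. x i)"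
| add: "polynomial_map N f \<Longrightarrow> polynomial_map N g \<Longrightarrow> polynomial_map N (\<lambda>x. f x + g x)"
| mult: "polynomial_map N f \<Longrightarrow> polynomial_map N g \<Longrightarrow> polynomial_map N (\<lambda>x. f x * g x)"

lemma polynomial_map_prod_mset:
  assumes "\<And>c. c \<in># M \<Longrightarrow> polynomial_map N (\<lambda>x. f x c)"
  shows "polynomial_map N (\<lambda>x. \<Prod>c\<in>#M. f x c)"
  using assms by (induction M) (auto intro: polynomial_map.intros)

lemma polynomial_map_partial:
  assumes "polynomial_map N f"
  shows "\<exists>f'. polynomial_map N f' \<and>
    (\<forall>x u. ((\<lambda>t. f (x(i := t))) has_real_derivative f' (x(i := u))) (at u))"
  using assms
proof induction
  case (const c)
  then show ?case
    by (intro exI[of _ "\<lambda>_. 0"]) (auto intro: polynomial_map.intros)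
next
  case (coordinate k)
  then show ?case
    by (intro exI[of _ "\<lambda>_. if k = i then 1 else 0"]) (auto intro: polynomial_map.intros)
next
  case (add f g)
  then obtain f' g' where fg: "polynomial_map N f'" "polynomial_map N g'"
    "\<And>x u. ((\<lambda>t. f (x(i := t))) has_real_derivative f' (x(i := u))) (at u)"
    "\<And>x u. ((\<lambda>t. g (x(i := t))) has_real_derivative g' (x(i := u))) (at u)"
    by blast
  show ?case
    by (intro exI[of _ "\<lambda>x. f' x + g' x"] conjI allI polynomial_map.intros DERIV_add fg)
next
  case (mult f g)
  then obtain f' g' where fg: "polynomial_map N f'" "polynomial_map N g'"
    "\<And>x u. ((\<lambda>t. f (x(i := t))) has_real_derivative f' (x(i := u))) (at u)"
    "\<And>x u. ((\<lambda>t. g (x(i := t))) has_real_derivative g' (x(i := u))) (at u)"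
    by blast
  show ?case
    by (intro exI[of _ "\<lambda>x. f' x * g x + g' x * f x"] conjI allI polynomial_map.intros
        DERIV_mult fg mult.hyps)
qed

lemma polynomial_map_iterated_partial:
  assumes "polynomial_map N f"
  shows "polynomial_map N (iterated_partial w f)"
proof (induction w)
  case Nil
  then show ?case using assms by (simp add: iterated_partial.simps)
next
  case (Cons i w)
  from polynomial_map_partial[OF Cons, of i] obtain f' where f': "polynomial_map N f'"
    "\<And>x u. ((\<lambda>t. iterated_partial w f (x(i := t))) has_real_derivative f' (x(i := u))) (at u)"
    by blast
  have "iterated_partial (i # w) f = f'"
    using DERIV_imp_deriv[OF f'(2)] by (simp add: iterated_partial.simps fun_eq_iff)
  then show ?case using f'(1) by simp
qed

lemma polynomial_map_smooth:
  assumes "polynomial_map N f"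
  shows "smooth_fun N f"
  unfolding smooth_fun_def
proof (intro allI impI conjI ballI)
  fix w
  have poly: "polynomial_map N (iterated_partial w f)"
    by (rule polynomial_map_iterated_partial) fact
  have "continuous_on UNIV h" if "polynomial_map N h" for h
    using that by induction (auto intro!: continuous_intros)
  then show "continuous_map (Euclidean_space N) euclideanreal (iterated_partial w f)"
    unfolding continuous_on_Euclidean_space using poly continuous_on_subset by blast
  show "(\<lambda>t. iterated_partial w f (x(i := t))) field_differentiable at (x i)" for i x
    using polynomial_map_partial[OF poly, of i] field_differentiable_def by blast
qed

lemma iterated_deriv_monomial:
  "\<exists>c' q'. (deriv ^^ k) (\<lambda>t::real. c * t ^ q) = (\<lambda>t. c' * t ^ q')"
proof (induction k)
  case (Suc k)
  then obtain c' q' where *: "(deriv ^^ k) (\<lambda>t::real. c * t ^ q) = (\<lambda>t. c' * t ^ q')"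
    by blast
  have "deriv (\<lambda>t. c' * t ^ q') = (\<lambda>t. (c' * real q') * t ^ (q' - 1))"
    by (rule ext, rule DERIV_imp_deriv) (auto intro!: derivative_eq_intros)
  then show ?case
    unfolding funpow.simps comp_def * by blast
qed auto

lemma monomial_bigo_imp_zero:
  assumes "(\<lambda>h::real. c * h ^ k) \<in> O[at 0](\<lambda>h. h ^ (p + 1))" "k \<le> p"
  shows "c = (0::real)"
proof -
  have "(\<lambda>h. c * h ^ k) \<in> O[at 0](\<lambda>h. h ^ (k + 1))"
    by (rule landau_o.big_trans[OF assms(1) power_bigo_power_at_0]) (use assms(2) in simp)
  also have "(\<lambda>h::real. h ^ (k + 1)) \<in> o[at 0](\<lambda>h. h ^ k)"
  proof (rule smalloI_tendsto)
    show "((\<lambda>h::real. h ^ (k + 1) / h ^ k) \<longlongrightarrow> 0) (at 0)"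
      by (rule Lim_transform_eventually[OF tendsto_ident_at])
        (auto simp: eventually_at intro!: exI[of _ 1])
  qed (rule eventually_mono[OF eventually_neq_at_within[of 0]], simp)
  finally have "((\<lambda>h. c * h ^ k / h ^ k) \<longlongrightarrow> 0) (at 0)"
    by (rule smalloD_tendsto)
  moreover have "((\<lambda>h. c * h ^ k / h ^ k) \<longlongrightarrow> c) (at 0)"
    by (rule tendsto_eventually) (auto simp: eventually_at intro!: exI[of _ 1])
  ultimately show ?thesis
    using tendsto_unique[OF trivial_limit_at] by blast
qed


section \<open>A problem that isolates one tree\<close>

lemma theta_inject [simp]: "theta q ts = theta q' ts' \<longleftrightarrow> q = q' \<and> ts = ts'"
proof (induction q arbitrary: q')
  case 0
  then show ?case by (cases q') auto
next
  case (Suc q)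
  then show ?case by (cases q') auto
qed

lemma lw2_subtree_shapes:
  assumes "lw2_subtree \<sigma>"
  obtains (Meagre) ts where "\<sigma> = Node Meagre ts"
    | (theta) q ts where "\<sigma> = theta q ts" "size ts \<le> 1"
proof (cases "root \<sigma>")
  case Meagre
  then show ?thesis using that(1)[of "children \<sigma>"] by (cases \<sigma>) simp
next
  case Fat
  from assms Fat show ?thesis
    by (cases rule: lw2_subtree.cases) (auto intro: that(2)[of 0])
next
  case Square
  then show ?thesis
    using lw2_subtree_square_cases[OF assms] that(2) by metis
qed

lemma Phi_bar_theta_prod:
  "Phi_bar s a \<gamma> j (theta 0 ts) = (\<Sum>k=1..s. \<gamma> j k * (\<Prod>\<tau>\<in>#ts. Phi_bar s a \<gamma> k \<tau>))"
  "q \<ge> 1 \<Longrightarrow> Phi_bar s a \<gamma> j (theta q ts) = \<gamma> j j ^ (q + 1) * (\<Prod>\<tau>\<in>#ts. Phi_bar s a \<gamma> j \<tau>)"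
proof -
  show "Phi_bar s a \<gamma> j (theta 0 ts) = (\<Sum>k=1..s. \<gamma> j k * (\<Prod>\<tau>\<in>#ts. Phi_bar s a \<gamma> k \<tau>))"
    by (simp add: Phi_bar_def image_mset.compositionality comp_def)
  assume "q \<ge> 1"
  then obtain r where q: "q = Suc r"
    by (cases q) auto
  have "Phi_bar s a \<gamma> j (theta q ts) = \<gamma> j j * Phi_bar_aux s a \<gamma> (theta r ts) True j"
    by (simp add: q Phi_bar_def)
  then show "Phi_bar s a \<gamma> j (theta q ts) = \<gamma> j j ^ (q + 1) * (\<Prod>\<tau>\<in>#ts. Phi_bar s a \<gamma> j \<tau>)"
    by (simp add: Phi_bar_aux_theta q)
qed

primrec subtrees :: "'k rtree \<Rightarrow> 'k rtree set" where
  "subtrees (Node c ts) = insert (Node c ts) (\<Union>(set_mset (image_mset subtrees ts)))"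

lemma finite_subtrees: "finite (subtrees \<tau>)"
  by (induction \<tau>) auto

lemma self_in_subtrees: "\<tau> \<in> subtrees \<tau>"
  by (cases \<tau>) simp

lemma children_in_subtrees: "\<sigma> \<in> subtrees \<tau> \<Longrightarrow> c \<in># children \<sigma> \<Longrightarrow> c \<in> subtrees \<tau>"
proof (induction \<tau>)
  case (Node k ts)
  then show ?case
    using self_in_subtrees[of c] by auto
qed

lemma lw2_subtree_children: "lw2_subtree \<sigma> \<Longrightarrow> c \<in># children \<sigma> \<Longrightarrow> lw2_subtree c"
  by (erule lw2_subtree.cases) auto

lemma lw2_subtree_subtrees: "lw2_subtree \<tau> \<Longrightarrow> \<sigma> \<in> subtrees \<tau> \<Longrightarrow> lw2_subtree \<sigma>"
proof (induction \<tau>)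
  case (Node k ts)
  then show ?case
    using lw2_subtree_children[OF Node.prems(1)] by auto
qed

lemma prod_mset_scaled_power:
  fixes h :: real
  shows "(\<Prod>c\<in>#M. h ^ r c * f c) = h ^ (\<Sum>c\<in>#M. r c) * (\<Prod>c\<in>#M. f c)"
  by (induction M) (simp_all add: power_add mult_ac)

text \<open>
  The two arguments of \<open>theta\<close>, recovered from a tree of this form; for other trees the values
  are arbitrary.
\<close>

definition squares :: "kind rtree \<Rightarrow> nat" where
  "squares \<sigma> = (THE q. \<exists>ts. \<sigma> = theta q ts)"

text \<open>What hangs below the fat vertex at the end of the chain: nothing or one tree.\<close>

definition crown :: "kind rtree \<Rightarrow> kind rtree multiset" where
  "crown \<sigma> = (THE ts. \<exists>q. \<sigma> = theta q ts)"

lemma squares_crown_theta [simp]: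
  "squares (theta q ts) = q" "crown (theta q ts) = ts"
  by (simp_all add: squares_def crown_def)

text \<open>
  The components of the test problem are numbered by the trees in a finite set that is closed under
  taking children, for example the subtrees of one tree. Isomorphic subtrees share a component.
  Component 0 belongs to no tree; it is constantly 1, because a fat leaf stands for
  the matrix applied to \<open>y0\<close> and would vanish for \<open>y0 = 0\<close>.
\<close>

locale tree_problem =
  fixes S :: "kind rtree set" and N :: nat and idx :: "kind rtree \<Rightarrow> nat"
    and node :: "nat \<Rightarrow> kind rtree"
  assumes idx: "\<sigma> \<in> S \<Longrightarrow> 0 < idx \<sigma> \<and> idx \<sigma> < N \<and> node (idx \<sigma>) = \<sigma>"
    and node: "0 < m \<Longrightarrow> m < N \<Longrightarrow> node m \<in> S \<and> idx (node m) = m"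
    and N_pos: "0 < N"
    and closed: "\<sigma> \<in> S \<Longrightarrow> c \<in># children \<sigma> \<Longrightarrow> c \<in> S"
    and lw2: "\<sigma> \<in> S \<Longrightarrow> lw2_subtree \<sigma>"
begin

text \<open>
  A meagre vertex multiplies the components of its children. In the row of a fat vertex, or of a
  chain of q squares that ends in one, the matrix has the single entry \<open>t ^ q\<close>, in the column of the
  child below or in column 0 if there is none; at \<open>t = 0\<close> only its q-th derivative is not zero. With this choice no higher
  powers of \<open>h\<close> arise: the component of a tree is a multiple of \<open>h ^ rho\<close>, both for the stages
  and for the exact solution.
\<close>

definition tree_field :: "(nat \<Rightarrow> real) \<Rightarrow> nat \<Rightarrow> real" where
  "tree_field x m = (if 0 < m \<and> m < N \<and> root (node m) = Meagre
     then \<Prod>c\<in>#children (node m). x (idx c) else 0)"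

definition source :: "kind rtree \<Rightarrow> nat" where
  "source \<sigma> = (if crown \<sigma> = {#} then 0 else idx (THE c. crown \<sigma> = {#c#}))"

definition tree_matrix :: "real \<Rightarrow> nat \<Rightarrow> nat \<Rightarrow> real" where
  "tree_matrix t m l = (if 0 < m \<and> m < N \<and> root (node m) \<noteq> Meagre \<and> l = source (node m)
     then t ^ squares (node m) else 0)"

definition tree_start :: "nat \<Rightarrow> real" where
  "tree_start m = (if m = 0 then 1 else 0)"

definition tree_flow :: "real \<Rightarrow> nat \<Rightarrow> real" where
  "tree_flow t m = (if m = 0 then 1 else if m < N \<and> set_rtree (node m) \<subseteq> {Meagre}
     then t ^ rho (node m) / real (tree_gamma (node m)) else 0)"

lemma crown_in_S: "theta q ts \<in> S \<Longrightarrow> c \<in># ts \<Longrightarrow> c \<in> S"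
proof (induction q)
  case 0
  then show ?case using closed[of "theta 0 ts" c] by simp
next
  case (Suc q)
  have "theta q ts \<in> S"
    using closed[OF Suc.prems(1), of "theta q ts"] by simp
  then show ?case using Suc by blast
qed

lemma smooth_tree_field: "smooth_vector_field N tree_field"
  unfolding smooth_vector_field_def
proof (intro conjI allI impI)
  show "tree_field \<in> topspace (Euclidean_space N) \<rightarrow> topspace (Euclidean_space N)"
    by (auto simp: topspace_Euclidean_space tree_field_def)
  show "smooth_fun N (\<lambda>x. tree_field x m)" for m
  proof (rule polynomial_map_smooth)
    show "polynomial_map N (\<lambda>x. tree_field x m)"
    proof (cases "0 < m \<and> m < N \<and> root (node m) = Meagre")
      case True
      then have "polynomial_map N (\<lambda>x. \<Prod>c\<in>#children (node m). x (idx c))"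
        using node[of m] closed[of "node m"] idx
        by (intro polynomial_map_prod_mset polynomial_map.coordinate) auto
      then show ?thesis
        using True by (simp add: tree_field_def)
    next
      case False
      then have "(\<lambda>x. tree_field x m) = (\<lambda>_. 0)"
        by (auto simp: tree_field_def)
      then show ?thesis
        by (simp add: polynomial_map.const)
    qed
  qed
qed

lemma smooth_tree_matrix: "smooth_matrix N tree_matrix"
  unfolding smooth_matrix_def
proof (intro allI impI)
  fix m l k and t :: real
  obtain c q where "(\<lambda>u. tree_matrix u m l) = (\<lambda>u. c * u ^ q)"
  proof (cases "0 < m \<and> m < N \<and> root (node m) \<noteq> Meagre \<and> l = source (node m)")
    case True
    then have "(\<lambda>u. tree_matrix u m l) = (\<lambda>u. 1 * u ^ squares (node m))"
      by (simp add: tree_matrix_def)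
    then show ?thesis by (rule that)
  next
    case False
    then have "(\<lambda>u. tree_matrix u m l) = (\<lambda>u. 0 * u ^ 0)"
      by (auto simp: tree_matrix_def fun_eq_iff)
    then show ?thesis by (rule that)
  qed
  moreover obtain c' q' where "(deriv ^^ k) (\<lambda>u. c * u ^ q) = (\<lambda>u. c' * u ^ q')"
    using iterated_deriv_monomial by blast
  ultimately have "(deriv ^^ k) (\<lambda>u. tree_matrix u m l) = (\<lambda>u. c' * u ^ q')"
    by simp
  then show "(deriv ^^ k) (\<lambda>u. tree_matrix u m l) field_differentiable at t"
    by (auto intro!: derivative_intros)
qed

lemma start_euc: "tree_start \<in> topspace (Euclidean_space N)"
  using N_pos by (auto simp: topspace_Euclidean_space tree_start_def)

text \<open>
  The component of a tree with a vertex that is not meagre stays 0: either the root is not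
  meagre, and the vector field has no such component, or some child has this property and makes the
  product over the children vanish.
\<close>

lemma flow_solution: "local_solution N tree_field 0 tree_start tree_flow"
  unfolding local_solution_def
proof (intro conjI exI[of _ 1] ballI allI impI)
  have "(0::real) ^ rho \<sigma> = 0" for \<sigma> :: "kind rtree"
    by (cases \<sigma>) simp
  then show "tree_flow 0 = tree_start"
    by (simp add: tree_flow_def tree_start_def fun_eq_iff)
  show "tree_flow t \<in> topspace (Euclidean_space N)" for t
    using N_pos by (auto simp: topspace_Euclidean_space tree_flow_def)
  fix t m assume m: "m < N"
  show "((\<lambda>u. tree_flow u m) has_real_derivative tree_field (tree_flow t) m) (at t)"
  proof (cases "m = 0")
    case True
    then show ?thesis by (simp add: tree_flow_def tree_field_def)
  next
    case False
    obtain k ts where nm: "node m = Node k ts"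
      by (cases "node m")
    have flow_child: "tree_flow t (idx c) = (if set_rtree c \<subseteq> {Meagre}
        then t ^ rho c / real (tree_gamma c) else 0)" if "c \<in># ts" for c
      using closed[of "node m" c] node[of m] idx[of c] False m that nm by (simp add: tree_flow_def)
    show ?thesis
    proof (cases "set_rtree (node m) \<subseteq> {Meagre}")
      case True
      then have k: "k = Meagre" and ch: "\<And>c. c \<in># ts \<Longrightarrow> set_rtree c \<subseteq> {Meagre}"
        using nm by auto
      have "tree_field (tree_flow t) m = (\<Prod>c\<in>#ts. tree_flow t (idx c))"
        using False m by (simp add: tree_field_def nm k)
      also have "\<dots> = (\<Prod>c\<in>#ts. t ^ rho c * (1 / real (tree_gamma c)))"
        by (intro arg_cong[where f = prod_mset] image_mset_cong) (use flow_child ch in simp)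
      also have "\<dots> = t ^ (\<Sum>c\<in>#ts. rho c) * (\<Prod>c\<in>#ts. 1 / real (tree_gamma c))"
        by (rule prod_mset_scaled_power)
      also have "(\<Prod>c\<in>#ts. 1 / real (tree_gamma c)) = 1 / real (\<Prod>c\<in>#ts. tree_gamma c)"
        by (induction ts) simp_all
      finally have field: "tree_field (tree_flow t) m = t ^ (\<Sum>c\<in>#ts. rho c) / real (\<Prod>c\<in>#ts. tree_gamma c)"
        by simp
      have "(\<lambda>u. tree_flow u m) = (\<lambda>u. u ^ rho (node m) / real (tree_gamma (node m)))"
        using True False m by (simp add: tree_flow_def)
      moreover have "((\<lambda>u. u ^ rho (node m) / real (tree_gamma (node m))) has_real_derivative
          real (rho (node m)) * t ^ (rho (node m) - 1) / real (tree_gamma (node m))) (at t)"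
        using DERIV_cdivide[OF DERIV_pow[of "rho (node m)" t]] by simp
      moreover have "real (rho (node m)) * t ^ (rho (node m) - 1) / real (tree_gamma (node m)) =
          tree_field (tree_flow t) m"
      proof -
        have "real (tree_gamma (node m)) = real (rho (node m)) * real (\<Prod>c\<in>#ts. tree_gamma c)"
          "rho (node m) - 1 = (\<Sum>c\<in>#ts. rho c)" "real (rho (node m)) \<noteq> 0"
          by (simp_all only: nm rho.simps tree_gamma.simps of_nat_mult)
        then show ?thesis
          unfolding field by simp
      qed
      ultimately show ?thesis by simp
    next
      case nonmeagre: False
      have "tree_field (tree_flow t) m = 0"
      proof (cases "k = Meagre")
        case True
        then obtain c where "c \<in># ts" "\<not> set_rtree c \<subseteq> {Meagre}"
          using nonmeagre nm by auto
        then have "0 \<in># image_mset (\<lambda>c. tree_flow t (idx c)) ts"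
          using flow_child by force
        then show ?thesis
          by (auto simp: tree_field_def nm prod_mset_zero_iff)
      qed (simp add: tree_field_def nm)
      then show ?thesis
        using nonmeagre False by (simp add: tree_flow_def)
    qed
  qed
qed auto

lemma mat_vec_matrix_theta:
  assumes m: "0 < m" "m < N" and th: "node m = theta q ts" "size ts \<le> 1"
  shows "mat_vec N (tree_matrix t) v m = t ^ q * (if ts = {#} then v 0 else \<Prod>c\<in>#ts. v (idx c))"
proof -
  have src: "source (node m) < N"
    "v (source (node m)) = (if ts = {#} then v 0 else \<Prod>c\<in>#ts. v (idx c))"
  proof -
    consider "ts = {#}" | c where "ts = {#c#}"
      using th(2) by (metis One_nat_def le_SucE le_zero_eq size_1_singleton_mset size_eq_0_iff_empty)
    then show "source (node m) < N"
      "v (source (node m)) = (if ts = {#} then v 0 else \<Prod>c\<in>#ts. v (idx c))"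
      using N_pos crown_in_S[of q ts] idx node[OF m] th by (cases; auto simp: source_def)+
  qed
  have "root (node m) \<noteq> Meagre"
    by (simp add: th root_theta)
  then have "mat_vec N (tree_matrix t) v m = (\<Sum>l<N. if l = source (node m) then t ^ q * v l else 0)"
    unfolding mat_vec_def using m th by (intro sum.cong) (auto simp: tree_matrix_def)
  then show ?thesis
    using src by simp
qed

lemma mat_vec_matrix_other:
  assumes "m = 0 \<or> root (node m) = Meagre"
  shows "mat_vec N (tree_matrix t) v m = 0"
  using assms by (auto simp: mat_vec_def tree_matrix_def)

definition tree_stage ::
    "nat \<Rightarrow> (nat \<Rightarrow> nat \<Rightarrow> real) \<Rightarrow> (nat \<Rightarrow> nat \<Rightarrow> real) \<Rightarrow> real \<Rightarrow> nat \<Rightarrow> nat \<Rightarrow> real" where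
  "tree_stage s a \<gamma> h i m = (if m = 0 then 1 else if m < N
     then h ^ rho (node m) * Phi_bar s a \<gamma> i (node m) else 0)"

lemma stage_idx: "\<sigma> \<in> S \<Longrightarrow> tree_stage s a \<gamma> h i (idx \<sigma>) = h ^ rho \<sigma> * Phi_bar s a \<gamma> i \<sigma>"
  using idx[of \<sigma>] by (simp add: tree_stage_def)

lemma prod_stage:
  assumes "\<And>c. c \<in># ts \<Longrightarrow> c \<in> S"
  shows "(\<Prod>c\<in>#ts. tree_stage s a \<gamma> h i (idx c)) =
    h ^ (\<Sum>c\<in>#ts. rho c) * (\<Prod>c\<in>#ts. Phi_bar s a \<gamma> i c)"
proof -
  have "(\<Prod>c\<in>#ts. tree_stage s a \<gamma> h i (idx c)) = (\<Prod>c\<in>#ts. h ^ rho c * Phi_bar s a \<gamma> i c)"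
    by (intro arg_cong[where f = prod_mset] image_mset_cong stage_idx assms)
  then show ?thesis
    by (simp add: prod_mset_scaled_power)
qed

lemma field_stage:
  assumes "0 < m" "m < N" "node m = Node Meagre ts"
  shows "tree_field (tree_stage s a \<gamma> h i) m =
    h ^ (\<Sum>c\<in>#ts. rho c) * (\<Prod>c\<in>#ts. Phi_bar s a \<gamma> i c)"
  using prod_stage[of ts] closed[of "node m"] node[of m] assms by (simp add: tree_field_def)

text \<open>
  A sum over stages can be moved out of the product over \<open>ts\<close>, because this product has at most one
  factor: the matrix acts linearly.
\<close>

lemma mat_vec_stages:
  assumes m: "0 < m" "m < N" and th: "node m = theta q ts" "size ts \<le> 1"
  shows "mat_vec N (tree_matrix t) (\<lambda>l. \<Sum>j\<in>J. c j * tree_stage s a \<gamma> h j l) m =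
    t ^ q * h ^ (\<Sum>c\<in>#ts. rho c) * (\<Sum>j\<in>J. c j * (\<Prod>\<tau>\<in>#ts. Phi_bar s a \<gamma> j \<tau>))"
proof -
  have "(if ts = {#} then \<Sum>j\<in>J. c j * tree_stage s a \<gamma> h j 0
      else \<Prod>\<sigma>\<in>#ts. \<Sum>j\<in>J. c j * tree_stage s a \<gamma> h j (idx \<sigma>)) =
    (\<Sum>j\<in>J. c j * (\<Prod>\<sigma>\<in>#ts. tree_stage s a \<gamma> h j (idx \<sigma>)))"
  proof -
    consider "ts = {#}" | \<sigma> where "ts = {#\<sigma>#}"
      using th(2) by (metis One_nat_def le_SucE le_zero_eq size_1_singleton_mset size_eq_0_iff_empty)
    then show ?thesis
      by cases (simp_all add: tree_stage_def)
  qed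
  moreover have "(\<Prod>\<sigma>\<in>#ts. tree_stage s a \<gamma> h j (idx \<sigma>)) =
      h ^ (\<Sum>c\<in>#ts. rho c) * (\<Prod>c\<in>#ts. Phi_bar s a \<gamma> j c)" for j
    by (rule prod_stage) (use crown_in_S node[OF m] th in auto)
  ultimately show ?thesis
    by (simp add: mat_vec_matrix_theta[OF m th] sum_distrib_left mult_ac)
qed

text \<open>
  Powers of \<open>h\<close> multiply along trees, so after cancelling them the stage equations become
  the recursion of the elementary weights.
\<close>

lemma tree_stage_stages:
  assumes a: "\<And>i j. i \<in> {1..s} \<Longrightarrow> j \<in> {1..s} \<Longrightarrow> j \<ge> i \<Longrightarrow> a i j = 0"
    and \<gamma>: "\<And>i j. i \<in> {1..s} \<Longrightarrow> j \<in> {1..s} \<Longrightarrow> j > i \<Longrightarrow> \<gamma> i j = 0"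
  shows "lirkw2_stages s a \<gamma> N tree_field tree_matrix 0 tree_start h (tree_stage s a \<gamma> h)"
  unfolding lirkw2_stages_def
proof (intro ballI conjI allI impI)
  fix i assume i: "i \<in> {1..s}"
  let ?Y = "tree_stage s a \<gamma> h" and ?P = "\<lambda>ts j. \<Prod>\<tau>\<in>#ts. Phi_bar s a \<gamma> j \<tau>"
  show "?Y i \<in> topspace (Euclidean_space N)"
    using N_pos by (auto simp: topspace_Euclidean_space tree_stage_def)
  fix m assume m: "m < N"
  show "?Y i m = tree_start m + h * (\<Sum>j=1..<i. a i j * tree_field (?Y j) m)
      + h * mat_vec N (tree_matrix 0) (\<lambda>l. \<Sum>j=1..<i. \<gamma> i j * ?Y j l) m
      + h * \<gamma> i i * mat_vec N (tree_matrix (0 + h * \<gamma> i i)) (?Y i) m"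
  proof (cases "m = 0")
    case True
    then show ?thesis
      by (simp add: tree_stage_def tree_start_def tree_field_def mat_vec_matrix_other)
  next
    case False
    then have m0: "0 < m" by simp
    from lw2[of "node m"] node[OF m0 m] have "lw2_subtree (node m)"
      by simp
    then show ?thesis
    proof (cases rule: lw2_subtree_shapes)
      case (Meagre ts)
      have "h * (\<Sum>j=1..<i. a i j * tree_field (?Y j) m) = h * (\<Sum>j=1..s. a i j * tree_field (?Y j) m)"
        using sum_strictly_lower[OF i, of "a i"] a[OF i] by simp
      also have "\<dots> = ?Y i m"
        using m0 m by (simp add: field_stage[OF m0 m Meagre] tree_stage_def Meagre Phi_bar_Meagre
            sum_distrib_left mult_ac)
      finally show ?thesis
        using m0 by (simp add: mat_vec_matrix_other Meagre tree_start_def)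
    next
      case (theta q ts)
      have root: "root (node m) \<noteq> Meagre"
        by (simp add: theta root_theta)
      have diag: "mat_vec N (tree_matrix t) (?Y i) m = t ^ q * h ^ (\<Sum>c\<in>#ts. rho c) * ?P ts i" for t
        using mat_vec_stages[OF m0 m theta, where J = "{i}" and c = "\<lambda>_. 1"] by simp
      have "h * mat_vec N (tree_matrix 0) (\<lambda>l. \<Sum>j=1..<i. \<gamma> i j * ?Y j l) m
          + h * \<gamma> i i * mat_vec N (tree_matrix (0 + h * \<gamma> i i)) (?Y i) m = ?Y i m"
      proof (cases "q = 0")
        case True
        \<comment> \<open>The matrix is constant here, so the implicit term completes the sum over the stages.\<close>
        have "(\<Sum>j=1..<i. \<gamma> i j * ?P ts j) + \<gamma> i i * ?P ts i = (\<Sum>j=1..s. \<gamma> i j * ?P ts j)"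
          by (rule sum_lower[OF i]) (use \<gamma>[OF i] in auto)
        then have Phi: "Phi_bar s a \<gamma> i (node m) = (\<Sum>j=1..<i. \<gamma> i j * ?P ts j) + \<gamma> i i * ?P ts i"
          using Phi_bar_theta_prod(1) theta True by metis
        show ?thesis
          using m0 m unfolding mat_vec_stages[OF m0 m theta] diag unfolding tree_stage_def Phi
          by (simp add: theta True algebra_simps)
      next
        case False
        \<comment> \<open>Now \<open>0 ^ q = 0\<close>, and only the implicit term is left.\<close>
        then show ?thesis
          using m0 m Phi_bar_theta_prod(2)[of q s a \<gamma> i ts]
          unfolding mat_vec_stages[OF m0 m theta] diag unfolding tree_stage_def
          by (simp add: theta power_mult_distrib power_add mult_ac)
      qed
      then show ?thesis
        using m0 root by (simp add: tree_start_def tree_field_def)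
    qed
  qed
qed

lemma update_idx:
  assumes \<tau>: "\<tau> \<in> S" "\<tau> \<in> LW2"
  shows "lirkw2_update s b g N tree_field tree_matrix 0 tree_start h (tree_stage s a \<gamma> h) (idx \<tau>) =
    h ^ rho \<tau> * (\<Sum>j=1..s. Phi s a \<gamma> b g j \<tau>)"
proof -
  let ?m = "idx \<tau>"
  have m: "0 < ?m" "?m < N" "node ?m = \<tau>"
    using idx[OF \<tau>(1)] by auto
  from \<tau>(2) have "lw2_subtree (node ?m)"
    by (simp add: LW2_def m)
  then show ?thesis
  proof (cases rule: lw2_subtree_shapes)
    case (Meagre ts)
    then show ?thesis
      unfolding lirkw2_update_def field_stage[OF m(1,2) Meagre]
      using m by (simp add: tree_start_def mat_vec_matrix_other Phi_def sum_distrib_left mult_ac)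
  next
    case (theta q ts)
    then have q: "q = 0"
      using \<tau>(2) m by (auto simp: LW2_def root_theta split: if_splits)
    then have root: "root (node ?m) \<noteq> Meagre"
      by (simp add: theta)
    show ?thesis
      unfolding lirkw2_update_def mat_vec_stages[OF m(1,2) theta]
      using m root theta q by (auto simp: tree_start_def tree_field_def Phi_def sum_distrib_left mult_ac)
  qed
qed

lemma flow_idx:
  assumes "\<tau> \<in> S"
  shows "tree_flow h (idx \<tau>) =
    h ^ rho \<tau> * (if set_rtree \<tau> \<subseteq> {Meagre} then 1 / real (tree_gamma \<tau>) else 0)"
  using idx[OF assms] by (simp add: tree_flow_def)

end

text \<open>
  In the component of \<open>\<tau>\<close>, the local error of the test problem on the subtrees of \<open>\<tau>\<close> is exactly
  \<open>h ^ rho \<tau>\<close> times the defect of the order condition for \<open>\<tau>\<close>. So the defect is 0 if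
  \<open>rho \<tau> \<le> p\<close>.
\<close>

lemma order_conditions_necessary:
  assumes order: "lirkw2_has_order s a \<gamma> b g p"
    and a: "\<And>i j. i \<in> {1..s} \<Longrightarrow> j \<in> {1..s} \<Longrightarrow> j \<ge> i \<Longrightarrow> a i j = 0"
    and \<gamma>: "\<And>i j. i \<in> {1..s} \<Longrightarrow> j \<in> {1..s} \<Longrightarrow> j > i \<Longrightarrow> \<gamma> i j = 0"
    and \<tau>: "\<tau> \<in> LW2" "rho \<tau> \<le> p"
  shows "(\<Sum>j=1..s. Phi s a \<gamma> b g j \<tau>) =
    (if set_rtree \<tau> \<subseteq> {Meagre} then 1 / real (tree_gamma \<tau>) else 0)"
proof -
  let ?S = "subtrees \<tau>"
  obtain f where f: "bij_betw f ?S {0..<card ?S}"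
    using ex_bij_betw_finite_nat[OF finite_subtrees] by blast
  define node where "node m = inv_into ?S f (m - 1)" for m
  interpret tree_problem ?S "Suc (card ?S)" "\<lambda>\<sigma>. Suc (f \<sigma>)" node
  proof
    show "0 < Suc (f \<sigma>) \<and> Suc (f \<sigma>) < Suc (card ?S) \<and> node (Suc (f \<sigma>)) = \<sigma>" if "\<sigma> \<in> ?S" for \<sigma>
      using f that by (auto simp: node_def bij_betw_def)
    show "node m \<in> ?S \<and> Suc (f (node m)) = m" if "0 < m" "m < Suc (card ?S)" for m
    proof -
      have "m - 1 \<in> f ` ?S"
        using f that by (auto simp: bij_betw_def)
      then show ?thesis
        using that by (simp add: node_def inv_into_into f_inv_into_f)
    qed
    show "c \<in> ?S" if "\<sigma> \<in> ?S" "c \<in># children \<sigma>" for \<sigma> c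
      using that by (rule children_in_subtrees)
    show "lw2_subtree \<sigma>" if "\<sigma> \<in> ?S" for \<sigma>
      using lw2_subtree_subtrees \<tau>(1) that by (auto simp: LW2_def)
  qed simp
  let ?m = "Suc (f \<tau>)"
  have "(\<lambda>h. lirkw2_update s b g (Suc (card ?S)) tree_field tree_matrix 0 tree_start h (tree_stage s a \<gamma> h) ?m -
      tree_flow (0 + h) ?m) \<in> O[at 0](\<lambda>h. h ^ (p + 1))"
    using order[unfolded lirkw2_has_order_def, rule_format, OF smooth_tree_field smooth_tree_matrix start_euc
        flow_solution always_eventually[OF allI[OF tree_stage_stages[OF a \<gamma>]]], of ?m]
      idx[OF self_in_subtrees] by simp
  then have "(\<lambda>h. ((\<Sum>j=1..s. Phi s a \<gamma> b g j \<tau>) -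
      (if set_rtree \<tau> \<subseteq> {Meagre} then 1 / real (tree_gamma \<tau>) else 0)) * h ^ rho \<tau>)
      \<in> O[at 0](\<lambda>h. h ^ (p + 1))"
    using update_idx[OF self_in_subtrees \<tau>(1)] flow_idx[OF self_in_subtrees]
    by (simp only: add_0 right_diff_distrib mult.commute)
  from monomial_bigo_imp_zero[OF this \<tau>(2)] show ?thesis
    by simp
qed


section \<open>The order conditions\<close>

theorem theorem3p2:
  fixes p s :: nat
    and a \<gamma> :: "nat \<Rightarrow> nat \<Rightarrow> real"
    and b g :: "nat \<Rightarrow> real"
  assumes "p \<ge> 1"
    and "\<And>i j. i \<in> {1..s} \<Longrightarrow> j \<in> {1..s} \<Longrightarrow> j \<ge> i \<Longrightarrow> a i j = 0"
    and "\<And>i j. i \<in> {1..s} \<Longrightarrow> j \<in> {1..s} \<Longrightarrow> j > i \<Longrightarrow> \<gamma> i j = 0"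
  shows "lirkw2_has_order s a \<gamma> b g p \<longleftrightarrow>
    (\<forall>\<tau>\<in>meagre_trees. rho \<tau> \<le> p \<longrightarrow>
       (\<Sum>j=1..s. Phi s a \<gamma> b g j \<tau>) = 1 / real (tree_gamma \<tau>)) \<and>
    (\<forall>\<tau>\<in>LW2 - meagre_trees. rho \<tau> \<le> p \<longrightarrow>
       (\<Sum>j=1..s. Phi s a \<gamma> b g j \<tau>) = 0)"
proof (intro iffI conjI ballI impI)
  fix \<tau> assume "lirkw2_has_order s a \<gamma> b g p" "\<tau> \<in> meagre_trees" "rho \<tau> \<le> p"
  then show "(\<Sum>j=1..s. Phi s a \<gamma> b g j \<tau>) = 1 / real (tree_gamma \<tau>)"
    using order_conditions_necessary[OF _ assms(2,3), where p = p and \<tau> = \<tau>] by (simp add: meagre_trees_def)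
next
  fix \<tau> assume "lirkw2_has_order s a \<gamma> b g p" "\<tau> \<in> LW2 - meagre_trees" "rho \<tau> \<le> p"
  then show "(\<Sum>j=1..s. Phi s a \<gamma> b g j \<tau>) = 0"
    using order_conditions_necessary[OF _ assms(2,3), where p = p and \<tau> = \<tau>] by (simp add: meagre_trees_def)
next
  assume "(\<forall>\<tau>\<in>meagre_trees. rho \<tau> \<le> p \<longrightarrow>
       (\<Sum>j=1..s. Phi s a \<gamma> b g j \<tau>) = 1 / real (tree_gamma \<tau>)) \<and>
    (\<forall>\<tau>\<in>LW2 - meagre_trees. rho \<tau> \<le> p \<longrightarrow>
       (\<Sum>j=1..s. Phi s a \<gamma> b g j \<tau>) = 0)"
  then show "lirkw2_has_order s a \<gamma> b g p"
    by (intro order_conditions_sufficient assms) auto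
qed

end
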